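(* Let $d\ge2$ be an integer. The integer shifts of every pseudo spline of type II, of every real pseudo spline of type I, and of every complex pseudo spline of type I (with dilation factor $d$, as defined in the context) are linearly independent; that is, for each such function $\phi$, if $c:\mathbb Z\to\mathbb C$ is any sequence with $\sum_{j\in\mathbb Z}c(j)\phi(\cdot-j)=0$, then $c(j)=0$ for all $j\in\mathbb Z$.
   Context: For a finitely supported $a:\mathbb Z\to\mathbb C$, $\widehat a(\xi)=\sum_{k}a(k)e^{-ik\xi}$. If $\widehat a(0)=1$, the $d$-refinable function $\phi$ associated with the low-pass filter $a$ is given by $\widehat\phi(\xi)=\prod_{j=1}^\infty\widehat a(d^{-j}\xi)$, so that $\phi=d\sum_k a(k)\phi(d\cdot-k)$; here $\widehat f(\xi)=\int_{\mathbb R} f(t)e^{-it\xi}dt$. For the filters below $\phi$ is a compactly supported function in $L_2(\mathbb R)$. Let $h(y)=\prod_{k=1}^{d-1}\big(1-\frac{y}{\sin^2(k\pi/d)}\big)$, so that $h(\sin^2(\xi/2))=\frac{|1+e^{-i\xi}+\cdots+e^{-i(d-1)\xi}|^2}{d^2}$. For positive integers $m,N$ let $P_{m,N}(y)=\sum_{j=0}^{N-1}c_{m,j}y^j$ with $c_{m,j}=\sum_{j_1+\cdots+j_{d-1}=j}\prod_{k=1}^{d-1}\binom{m-1+j_k}{j_k}(\sin(k\pi/d))^{-2j_k}$ (sum over nonnegative integers $j_1,\dots,j_{d-1}$). Type II: for positive integers $n\le m$, the pseudo spline of type II is the $d$-refinable function associated with the filter $\widehat a(\xi)=h(\sin^2(\xi/2))^mP_{m,n}(\sin^2(\xi/2))$.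 Real type I: for positive integers $n\le m$, a real pseudo spline of type I is the $d$-refinable function associated with a finitely supported real filter $a$ (obtained by the Riesz lemma) with $\widehat a(0)=1$ and $|\widehat a(\xi)|^2=h(\sin^2(\xi/2))^mP_{m,n}(\sin^2(\xi/2))$. Complex type I: for positive integers $m,n$ with $2n-1\le m$, $P_{m,2n-1}$ is positive on $\mathbb R$, so its roots can be listed (with multiplicity) as $z_1,\overline{z_1},\dots,z_{n-1},\overline{z_{n-1}}\in\mathbb C\setminus\mathbb R$. Put $Q_{m,n}(y)=(-1)^{n-1}(z_1\cdots z_{n-1})^{-1}(y-z_1)\cdots(y-z_{n-1})$. A complex pseudo spline of type I is the $d$-refinable function associated with the filter $\widehat{a_0}(\xi)=e^{i\lfloor\frac{m(d-1)}{2}\rfloor\xi}\big(\frac{1+e^{-i\xi}+\cdots+e^{-i(d-1)\xi}}{d}\big)^mQ_{m,n}(\sin^2(\xi/2))$. *)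

theory Defs
  imports "HOL-Analysis.Analysis" "HOL-Computational_Algebra.Computational_Algebra"
begin

definition symbol :: "(int \<Rightarrow> complex) \<Rightarrow> real \<Rightarrow> complex" where
  "symbol a \<xi> = (\<Sum>k | a k \<noteq> 0. a k * exp (- \<i> * of_int k * of_real \<xi>))"

definition low_pass_filter :: "(int \<Rightarrow> complex) \<Rightarrow> bool" where
  "low_pass_filter a \<longleftrightarrow> finite {k. a k \<noteq> 0} \<and> symbol a 0 = 1"

definition fourier :: "(real \<Rightarrow> complex) \<Rightarrow> real \<Rightarrow> complex" where
  "fourier f \<xi> = (LINT t|lebesgue. f t * exp (- \<i> * of_real t * of_real \<xi>))"

definition L2_function :: "(real \<Rightarrow> complex) \<Rightarrow> bool" where
  "L2_function f \<longleftrightarrow> f \<in> borel_measurable lebesgue \<and> integrable lebesgue (\<lambda>t. (cmod (f t))\<^sup>2)"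

(* Functions represent their classes modulo null sets, hence the almost-everywhere conditions. *)
definition compactly_supported :: "(real \<Rightarrow> complex) \<Rightarrow> bool" where
  "compactly_supported f \<longleftrightarrow> (\<exists>K. compact K \<and> (AE t in lebesgue. t \<notin> K \<longrightarrow> f t = 0))"

(* The Fourier transform determines \<phi> up to a null set; the factor with index j of the product
   is the one with argument \<xi> / d^(j+1), as has_prod counts from 0. *)
definition refinable_function :: "nat \<Rightarrow> (int \<Rightarrow> complex) \<Rightarrow> (real \<Rightarrow> complex) \<Rightarrow> bool" where
  "refinable_function d a \<phi> \<longleftrightarrow>
     L2_function \<phi> \<and> compactly_supported \<phi> \<and>
     (\<forall>\<xi>. (\<lambda>j. symbol a (\<xi> / real d ^ Suc j)) has_prod fourier \<phi> \<xi>)"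

definition h :: "nat \<Rightarrow> real \<Rightarrow> real" where
  "h d y = (\<Prod>k=1..d-1. 1 - y / (sin (real k * pi / real d))\<^sup>2)"

(* The bound {..j} loses no tuple of sum j and makes the index set visibly finite. *)
definition coeff_c :: "nat \<Rightarrow> nat \<Rightarrow> nat \<Rightarrow> real" where
  "coeff_c d m j =
     (\<Sum>js | js \<in> {1..d-1} \<rightarrow>\<^sub>E {..j} \<and> (\<Sum>k=1..d-1. js k) = j.
        \<Prod>k=1..d-1. real ((m - 1 + js k) choose js k) *
          inverse (sin (real k * pi / real d)) ^ (2 * js k))"

definition P :: "nat \<Rightarrow> nat \<Rightarrow> nat \<Rightarrow> real poly" where
  "P d m N = (\<Sum>j<N. monom (coeff_c d m j) j)"

definition type_II_mask :: "nat \<Rightarrow> nat \<Rightarrow> nat \<Rightarrow> real \<Rightarrow> real" where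
  "type_II_mask d m n \<xi> = h d ((sin (\<xi> / 2))\<^sup>2) ^ m * poly (P d m n) ((sin (\<xi> / 2))\<^sup>2)"

definition pseudo_spline_type_II :: "nat \<Rightarrow> nat \<Rightarrow> nat \<Rightarrow> (real \<Rightarrow> complex) \<Rightarrow> bool" where
  "pseudo_spline_type_II d m n \<phi> \<longleftrightarrow>
     1 \<le> n \<and> n \<le> m \<and>
     (\<exists>a. low_pass_filter a \<and>
          (\<forall>\<xi>. symbol a \<xi> = of_real (type_II_mask d m n \<xi>)) \<and>
          refinable_function d a \<phi>)"

(* Every real spectral factor is admitted, since the Riesz lemma does not single one out. *)
definition real_pseudo_spline_type_I :: "nat \<Rightarrow> nat \<Rightarrow> nat \<Rightarrow> (real \<Rightarrow> complex) \<Rightarrow> bool" where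
  "real_pseudo_spline_type_I d m n \<phi> \<longleftrightarrow>
     1 \<le> n \<and> n \<le> m \<and>
     (\<exists>a. low_pass_filter a \<and> (\<forall>k. a k \<in> \<real>) \<and>
          (\<forall>\<xi>. (cmod (symbol a \<xi>))\<^sup>2 = type_II_mask d m n \<xi>) \<and>
          refinable_function d a \<phi>)"

(* zs contains one root from each of the n - 1 conjugate pairs of roots of P d m (2 * n - 1),
   listed with multiplicity. *)
definition root_selection :: "nat \<Rightarrow> nat \<Rightarrow> nat \<Rightarrow> complex list \<Rightarrow> bool" where
  "root_selection d m n zs \<longleftrightarrow>
     length zs = n - 1 \<and> set zs \<inter> \<real> = {} \<and>
     proots (map_poly complex_of_real (P d m (2 * n - 1))) = mset zs + mset (map cnj zs)"

definition Q :: "complex list \<Rightarrow> complex \<Rightarrow> complex" where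
  "Q zs y = (- 1) ^ length zs * inverse (prod_list zs) * (\<Prod>z\<leftarrow>zs. y - z)"

definition complex_pseudo_spline_type_I :: "nat \<Rightarrow> nat \<Rightarrow> nat \<Rightarrow> (real \<Rightarrow> complex) \<Rightarrow> bool" where
  "complex_pseudo_spline_type_I d m n \<phi> \<longleftrightarrow>
     1 \<le> n \<and> 2 * n - 1 \<le> m \<and>
     (\<exists>a zs. low_pass_filter a \<and> root_selection d m n zs \<and>
          (\<forall>\<xi>. symbol a \<xi> =
             exp (\<i> * of_nat (m * (d - 1) div 2) * of_real \<xi>) *
             ((\<Sum>k<d. exp (- \<i> * of_nat k * of_real \<xi>)) / of_nat d) ^ m *
             Q zs (of_real ((sin (\<xi> / 2))\<^sup>2))) \<and>
          refinable_function d a \<phi>)"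

(* For compactly supported \<phi> the series has, for almost every t, only finitely many nonzero
   terms, so no condition on the growth of c is needed. *)
definition linearly_independent_shifts :: "(real \<Rightarrow> complex) \<Rightarrow> bool" where
  "linearly_independent_shifts \<phi> \<longleftrightarrow>
     (\<forall>c :: int \<Rightarrow> complex.
        (AE t in lebesgue. ((\<lambda>j. c j * \<phi> (t - of_int j)) has_sum 0) UNIV) \<longrightarrow> (\<forall>j. c j = 0))"

end

theory Submission
  imports Defs "HOL-Complex_Analysis.Complex_Analysis"
begin

text \<open>Suppose that a nonzero sequence \<open>c\<close> annihilates the shifts of \<open>\<phi>\<close>. The argument turns \<open>c\<close> into zeros
of the entire function \<open>F(\<zeta>) = \<integral> \<phi>(t) exp(-i t \<zeta>) dt\<close> and then drives those zeros to the
real line, where the infinite product forbids them.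

From sequences to zeros. For almost every \<open>t\<close> the finitely many values \<open>\<phi>(t - i)\<close> are the
coefficients of a Laurent polynomial in the shift that kills \<open>c\<close>. The polynomials that kill \<open>c\<close> form
a proper ideal of a principal ideal domain whose generator may be taken with nonzero constant term,
so they share a root \<open>z \<noteq> 0\<close> (\<open>exponential_in_annihilator\<close>), which means that the single
exponential sequence \<open>z^i\<close> is a dependence relation too. Integrating that relation against
exponentials over a period gives \<open>\<zeta>\<close> with \<open>F(\<zeta> + 2 \<pi> k) = 0\<close> for all integers \<open>k\<close>
(\<open>dependent_shifts_imp_common_zeros\<close>).

Descent. On the complex plane \<open>F(d \<zeta>) = A(\<zeta>) F(\<zeta>)\<close>, where \<open>A\<close> is the trigonometric polynomial of
the filter. If \<open>\<zeta>\<close> is a nonreal common zero and \<open>A\<close> does not vanish at all of the points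
\<open>(\<zeta> + 2 \<pi> k) / d\<close>, \<open>k < d\<close>, then one of these points is again a common zero, with an imaginary part
\<open>d\<close> times smaller. Common zeros modulo \<open>2 \<pi>\<close> and of bounded imaginary part form a compact set, so one
of least absolute imaginary part exists and must be real. A real zero of \<open>F\<close> makes a factor of the
product vanish; all real zeros of \<open>A\<close> lie in \<open>(2 \<pi> / d) \<int>\<close>, hence the zero lies in \<open>2 \<pi> \<int>\<close>, so
\<open>0\<close> is among its translates, in contradiction to \<open>F(0) = 1\<close>. This is
\<open>linearly_independent_of_symbol_zeros\<close>.

No symmetric zeros. For all three families a zero \<open>\<zeta>\<close> of \<open>A\<close> either satisfies \<open>d \<zeta> \<in> 2 \<pi> \<int>\<close> or makes
\<open>y = sin^2(\<zeta>/2)\<close> a root of the polynomial \<open>P_{m,N}\<close> for some \<open>N \<le> m\<close>. The coefficients of that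
polynomial are positive and at least double from each to the next, because
\<open>(j+1) c_{j+1} \<ge> (m+j) c_j\<close>. By the Enestrom-Kakeya theorem its roots lie in the disc
\<open>|y| \<le> 1/2\<close>, and they avoid the point \<open>1/2\<close>, so their real parts are less than \<open>1/2\<close>. However the
numbers \<open>sin^2((\<zeta> + 2 \<pi> k / d)/2)\<close>, \<open>k < d\<close>, have average \<open>1/2\<close>, so they cannot all be roots
(\<open>P_not_all_roots_on_grid\<close>).\<close>

section \<open>Sequences annihilated by polynomials in the shift\<close>

definition apply_shift_poly :: "(int \<Rightarrow> complex) \<Rightarrow> complex poly \<Rightarrow> int \<Rightarrow> complex" where
  "apply_shift_poly c p l = (\<Sum>i\<le>degree p. coeff p i * c (l + int i))"

lemma apply_shift_poly_bound:
  assumes "degree p \<le> N"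
  shows "apply_shift_poly c p l = (\<Sum>i\<le>N. coeff p i * c (l + int i))"
  unfolding apply_shift_poly_def
  using assms by (intro sum.mono_neutral_left) (auto simp: coeff_eq_0)

lemma apply_shift_poly_0 [simp]: "apply_shift_poly c 0 l = 0"
  by (simp add: apply_shift_poly_def)

lemma apply_shift_poly_add:
  "apply_shift_poly c (p + q) l = apply_shift_poly c p l + apply_shift_poly c q l"
proof -
  let ?N = "max (degree p) (degree q)"
  have "degree (p + q) \<le> ?N" by (rule degree_add_le_max)
  then show ?thesis
    by (simp add: apply_shift_poly_bound[of _ ?N] sum.distrib algebra_simps)
qed

lemma apply_shift_poly_smult:
  "apply_shift_poly c (smult a p) l = a * apply_shift_poly c p l"
  by (simp add: apply_shift_poly_bound[of "smult a p" "degree p"] degree_smult_le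
      apply_shift_poly_def sum_distrib_left mult.assoc)

lemma apply_shift_poly_pCons:
  "apply_shift_poly c (pCons a p) l = a * c l + apply_shift_poly c p (l + 1)"
proof -
  have "apply_shift_poly c (pCons a p) l
      = (\<Sum>i\<le>Suc (degree p). coeff (pCons a p) i * c (l + int i))"
    by (intro apply_shift_poly_bound degree_pCons_le)
  also have "\<dots> = a * c l + (\<Sum>i\<le>degree p. coeff p i * c (l + 1 + int i))"
    by (subst sum.atMost_Suc_shift) (simp add: algebra_simps)
  finally show ?thesis by (simp add: apply_shift_poly_def)
qed

lemma apply_shift_poly_sum:
  "apply_shift_poly c (\<Sum>i\<in>S. p i) l = (\<Sum>i\<in>S. apply_shift_poly c (p i) l)"
  by (induction S rule: infinite_finite_induct) (simp_all add: apply_shift_poly_add)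

lemma apply_shift_poly_monom:
  "apply_shift_poly c (monom a n) l = a * c (l + int n)"
  by (induction n arbitrary: l)
     (simp_all add: monom_0 monom_Suc apply_shift_poly_pCons algebra_simps)

lemma apply_shift_poly_mult_eq_0:
  assumes "\<And>l. apply_shift_poly c p l = 0"
  shows "apply_shift_poly c (q * p) l = 0"
  by (induction q arbitrary: l)
     (simp_all add: apply_shift_poly_add apply_shift_poly_smult apply_shift_poly_pCons assms)

text \<open>The polynomials that annihilate \<open>c\<close> form an ideal, and a nonzero member \<open>p\<close> of least degree
generates it. Its constant term is nonzero, since the shift is invertible on two-sided sequences
and a factor \<open>x\<close> could be cancelled; its degree is positive, since \<open>c \<noteq> 0\<close>. So it has a root, which is
nonzero and common to all of its multiples.\<close>

lemma annihilating_polys_common_root: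
  assumes "c l0 \<noteq> 0"
  shows "\<exists>z. z \<noteq> 0 \<and> (\<forall>q. (\<forall>l. apply_shift_poly c q l = 0) \<longrightarrow> poly q z = 0)"
proof -
  define R where "R p \<longleftrightarrow> p \<noteq> 0 \<and> (\<forall>l. apply_shift_poly c p l = 0)" for p
  show ?thesis
  proof (cases "\<exists>p. R p")
    case False
    then have "poly q 1 = 0" if "\<forall>l. apply_shift_poly c q l = 0" for q
      using that by (cases "q = 0") (auto simp: R_def)
    \<comment> \<open>Only the zero polynomial annihilates \<open>c\<close>, so every number is a common root.\<close>
    then show ?thesis by (intro exI[of _ 1] conjI) simp_all
  next
    case True
    then obtain p0 where "R p0" by (elim exE)
    then obtain p where "R p" and min: "\<forall>q. R q \<longrightarrow> degree p \<le> degree q"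
      using ex_has_least_nat[of R p0 degree] by (metis (no_types))
    then have p: "p \<noteq> 0" "\<And>l. apply_shift_poly c p l = 0" by (simp_all add: R_def)
    have p_min: "degree p \<le> degree q" if "q \<noteq> 0" "\<And>l. apply_shift_poly c q l = 0" for q
      using min that by (simp add: R_def)
    have coeff0: "coeff p 0 \<noteq> 0"
    proof
      assume 0: "coeff p 0 = 0"
      obtain a q where q: "p = pCons a q" by (cases p)
      with 0 p have "a = 0" "q \<noteq> 0" by auto
      have "apply_shift_poly c q l = 0" for l
        using p(2)[of "l - 1"] by (simp add: q \<open>a = 0\<close> apply_shift_poly_pCons)
      from p_min[OF \<open>q \<noteq> 0\<close> this] \<open>q \<noteq> 0\<close> show False by (simp add: q)
    qed
    have "degree p \<noteq> 0"
    proof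
      assume "degree p = 0"
      then have "apply_shift_poly c p l0 = coeff p 0 * c l0"
        by (simp add: apply_shift_poly_def)
      with p assms coeff0 show False by auto
    qed
    then have "\<not> constant (poly p)" by (simp add: constant_degree)
    then have "\<exists>z. poly p z = 0" by (rule Fundamental_Theorem_Algebra.fundamental_theorem_of_algebra)
    then obtain z where z: "poly p z = 0" by (elim exE)
    show ?thesis
    proof (intro exI[of _ z] conjI allI impI)
      show "z \<noteq> 0" using z coeff0 by (auto simp: poly_0_coeff_0)
      fix q assume q: "\<forall>l. apply_shift_poly c q l = 0"
      have mod: "apply_shift_poly c (q mod p) l = 0" for l
      proof -
        have "q = q div p * p + q mod p" by simp
        then have "apply_shift_poly c q l
            = apply_shift_poly c (q div p * p) l + apply_shift_poly c (q mod p) l"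
          by (metis apply_shift_poly_add)
        then show ?thesis using q apply_shift_poly_mult_eq_0[OF p(2)] by simp
      qed
      have "q mod p = 0"
      proof (rule ccontr)
        assume nz: "q mod p \<noteq> 0"
        have "degree p \<le> degree (q mod p)" by (rule p_min[OF nz mod])
        with degree_mod_less[OF p(1), of q] nz show False by simp
      qed
      then have "p dvd q" by auto
      then show "poly q z = 0" using z by auto
    qed
  qed
qed

text \<open>The Laurent version of the previous lemma. It says that every finite linear relation between the
translates of \<open>c\<close> also holds for one exponential sequence.\<close>

lemma exponential_in_annihilator:
  assumes "c l0 \<noteq> (0::complex)"
  shows "\<exists>z. z \<noteq> 0 \<and> (\<forall>S f. finite S \<longrightarrow> (\<forall>l::int. (\<Sum>i\<in>S. f i * c (l + i)) = 0)
              \<longrightarrow> (\<Sum>i\<in>S. f i * z powi i) = 0)"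
proof -
  obtain z where z: "z \<noteq> 0" "\<And>q. \<forall>l. apply_shift_poly c q l = 0 \<Longrightarrow> poly q z = 0"
    using annihilating_polys_common_root[where c = c, OF assms] by auto
  show ?thesis
  proof (intro exI[of _ z] conjI allI impI)
    show "z \<noteq> 0" by (rule z(1))
  next
    fix S :: "int set" and f :: "int \<Rightarrow> complex"
    assume S: "finite S" and f: "\<forall>l. (\<Sum>i\<in>S. f i * c (l + i)) = 0"
    obtain L :: int where L: "\<And>i. i \<in> S \<Longrightarrow> L \<le> i"
      using bdd_below_finite[OF S] by (auto simp: bdd_below_def)
    let ?q = "\<Sum>i\<in>S. monom (f i) (nat (i - L))"
    have "apply_shift_poly c ?q l = 0" for l
    proof -
      have "apply_shift_poly c ?q l = (\<Sum>i\<in>S. f i * c ((l - L) + i))"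
        unfolding apply_shift_poly_sum apply_shift_poly_monom
        using L by (intro sum.cong) (auto simp: algebra_simps)
      then show ?thesis using f by simp
    qed
    then have "poly ?q z = 0" by (intro z(2) allI)
    moreover have "poly ?q z = z powi (- L) * (\<Sum>i\<in>S. f i * z powi i)"
      unfolding poly_sum poly_monom sum_distrib_left
    proof (rule sum.cong[OF refl])
      fix i assume "i \<in> S"
      then have "z ^ nat (i - L) = z powi (i - L)" using L by (simp add: power_int_def)
      also have "\<dots> = z powi i * z powi (- L)"
        using z(1) unfolding diff_conv_add_uminus by (intro power_int_add) simp
      finally show "f i * z ^ nat (i - L) = z powi - L * (f i * z powi i)" by simp
    qed
    ultimately show "(\<Sum>i\<in>S. f i * z powi i) = 0" using z(1) by simp
  qed
qed

section \<open>The Fourier-Laplace transform and dependent shifts\<close>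

definition fourier_laplace :: "(real \<Rightarrow> complex) \<Rightarrow> complex \<Rightarrow> complex" where
  "fourier_laplace f \<zeta> = (LINT t|lebesgue. f t * exp (- \<i> * of_real t * \<zeta>))"

definition vanishes_beyond :: "real \<Rightarrow> (real \<Rightarrow> complex) \<Rightarrow> bool" where
  "vanishes_beyond B f \<longleftrightarrow> (AE t in lebesgue. B < \<bar>t\<bar> \<longrightarrow> f t = 0)"

lemma fourier_eq_fourier_laplace: "fourier f \<xi> = fourier_laplace f (of_real \<xi>)"
  by (simp add: fourier_def fourier_laplace_def)

lemma compactly_supported_vanishes_beyond:
  assumes "compactly_supported f"
  obtains B where "0 < B" "vanishes_beyond B f"
proof -
  obtain K where K: "compact K" "AE t in lebesgue. t \<notin> K \<longrightarrow> f t = 0"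
    using assms by (auto simp: compactly_supported_def)
  obtain a where a: "\<forall>t\<in>K. \<bar>t\<bar> \<le> a"
    using compact_imp_bounded[OF K(1)] by (auto simp: bounded_real)
  have "vanishes_beyond (max a 1) f"
    unfolding vanishes_beyond_def using K(2)
  proof eventually_elim
    case (elim t)
    show ?case
    proof
      assume "max a 1 < \<bar>t\<bar>"
      then have "t \<notin> K" using a by force
      then show "f t = 0" using elim by blast
    qed
  qed
  then show ?thesis by (intro that[of "max a 1"]) auto
qed

lemma integrable_of_L2:
  assumes "L2_function f" "vanishes_beyond B f"
  shows "integrable lebesgue f"
proof (rule Bochner_Integration.integrable_bound)
  show "integrable lebesgue (\<lambda>t. (cmod (f t))\<^sup>2 + indicator {-B..B} t)"
  proof (rule Bochner_Integration.integrable_add)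
    show "integrable lebesgue (\<lambda>t. (cmod (f t))\<^sup>2)" using assms(1) by (simp add: L2_function_def)
    show "integrable lebesgue (indicator {-B..B} :: real \<Rightarrow> real)"
      by (rule integrable_real_indicator) (simp_all add: emeasure_lborel_Icc_eq)
  qed
  show "f \<in> borel_measurable lebesgue" using assms(1) by (simp add: L2_function_def)
  show "AE t in lebesgue. norm (f t) \<le> norm ((cmod (f t))\<^sup>2 + indicator {-B..B} t)"
    using assms(2) unfolding vanishes_beyond_def
  proof eventually_elim
    case (elim t)
    have "cmod (f t) \<le> (cmod (f t))\<^sup>2 + 1"
    proof -
      have "0 \<le> (cmod (f t) - 1)\<^sup>2" by simp
      then have "2 * cmod (f t) \<le> (cmod (f t))\<^sup>2 + 1" by (simp add: power2_diff)
      then show ?thesis using norm_ge_zero[of "f t"] by linarith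
    qed
    moreover have "f t = 0" if "t \<notin> {-B..B}" using elim that by (auto simp: abs_if split: if_splits)
    ultimately show ?case by (cases "t \<in> {-B..B}") simp_all
  qed
qed

lemma continuous_imp_lebesgue_measurable:
  fixes u :: "real \<Rightarrow> complex"
  assumes "continuous_on UNIV u"
  shows "u \<in> borel_measurable lebesgue"
  using borel_measurable_continuous_onI[OF assms] by (simp add: measurable_completion)

lemma integrable_times_continuous:
  assumes f: "integrable lebesgue f" "vanishes_beyond B f"
    and u: "continuous_on UNIV u" "\<And>t. \<bar>t\<bar> \<le> B \<Longrightarrow> cmod (u t) \<le> C"
  shows "integrable lebesgue (\<lambda>t. f t * u t)"
    and "(LINT t|lebesgue. cmod (f t * u t)) \<le> (LINT t|lebesgue. cmod (f t)) * C"
proof -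
  have u_meas: "u \<in> borel_measurable lebesgue"
    using u(1) by (rule continuous_imp_lebesgue_measurable)
  have bound: "AE t in lebesgue. norm (f t * u t) \<le> cmod (f t) * C"
    using f(2) unfolding vanishes_beyond_def
  proof eventually_elim
    case (elim t)
    show ?case
    proof (cases "\<bar>t\<bar> \<le> B")
      case True
      then show ?thesis using u(2) by (simp add: norm_mult mult_left_mono)
    qed (use elim in simp)
  qed
  have int: "integrable lebesgue (\<lambda>t. cmod (f t) * C)" using f(1) by simp
  show fu: "integrable lebesgue (\<lambda>t. f t * u t)"
  proof (rule Bochner_Integration.integrable_bound[OF int])
    show "(\<lambda>t. f t * u t) \<in> borel_measurable lebesgue"
      using borel_measurable_integrable[OF f(1)] u_meas by simp
    show "AE t in lebesgue. norm (f t * u t) \<le> norm (cmod (f t) * C)"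
      using bound by eventually_elim simp
  qed
  have "(LINT t|lebesgue. cmod (f t * u t)) \<le> (LINT t|lebesgue. cmod (f t) * C)"
    using fu int bound by (intro integral_mono_AE) auto
  then show "(LINT t|lebesgue. cmod (f t * u t)) \<le> (LINT t|lebesgue. cmod (f t)) * C" by simp
qed

text \<open>Expanding the exponential gives a power series in \<open>\<zeta>\<close> whose coefficients are the moments of \<open>f\<close>;
on the support of \<open>f\<close> it is dominated by the exponential series of \<open>B |\<zeta>|\<close>, so sum and integral may
be exchanged.\<close>

lemma fourier_laplace_entire:
  assumes f: "integrable lebesgue f" "vanishes_beyond B f" "0 < B"
  shows "fourier_laplace f holomorphic_on S"
proof -
  define a where "a n = (LINT t|lebesgue. f t * ((- \<i> * of_real t) ^ n / fact n))" for n
  have sums: "(\<lambda>n. a n * (\<zeta> - 0) ^ n) sums fourier_laplace f \<zeta>" for \<zeta>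
  proof -
    define g where "g n t = f t * ((- \<i> * of_real t * \<zeta>) ^ n / fact n)" for n t
    have cont: "continuous_on UNIV (\<lambda>t. (- \<i> * of_real t * \<zeta>) ^ n / fact n)" for n
      by (intro continuous_intros) simp
    have bd: "cmod ((- \<i> * of_real t * \<zeta>) ^ n / fact n) \<le> (B * cmod \<zeta>) ^ n / fact n"
      if "\<bar>t\<bar> \<le> B" for t n
      using that by (simp add: norm_divide norm_power norm_mult divide_right_mono power_mono mult_right_mono)
    have gi: "integrable lebesgue (g n)" for n
      unfolding g_def by (rule integrable_times_continuous(1)[OF f(1,2) cont bd])
    have pointwise: "(\<lambda>n. g n t) sums (f t * exp (- \<i> * of_real t * \<zeta>))" for t
      unfolding g_def using exp_converges[of "- \<i> * of_real t * \<zeta>"]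
      by (intro sums_mult) (simp add: scaleR_conv_of_real divide_inverse mult.commute)
    have "(\<lambda>n. integral\<^sup>L lebesgue (g n)) sums (LINT t|lebesgue. (\<Sum>n. g n t))"
    proof (rule sums_integral[OF gi])
      show "AE t in lebesgue. summable (\<lambda>n. norm (g n t))"
      proof (rule AE_I2)
        fix t
        have "summable (\<lambda>n. cmod (f t) * (norm (- \<i> * of_real t * \<zeta>) ^ n /\<^sub>R fact n))"
          by (intro summable_mult summable_exp_generic)
        then show "summable (\<lambda>n. norm (g n t))"
          by (simp add: g_def norm_mult norm_divide norm_power divide_inverse norm_inverse mult.commute)
      qed
      have "summable (\<lambda>n. (LINT t|lebesgue. cmod (f t)) * ((B * cmod \<zeta>) ^ n /\<^sub>R fact n))"
        by (intro summable_mult summable_exp_generic)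
      then have "summable (\<lambda>n. (LINT t|lebesgue. cmod (f t)) * ((B * cmod \<zeta>) ^ n / fact n))"
        by (simp add: divide_inverse mult.commute)
      then show "summable (\<lambda>n. LINT t|lebesgue. norm (g n t))"
      proof (rule summable_comparison_test')
        fix n
        show "norm (LINT t|lebesgue. norm (g n t))
            \<le> (LINT t|lebesgue. cmod (f t)) * ((B * cmod \<zeta>) ^ n / fact n)"
          using integrable_times_continuous(2)[OF f(1,2) cont bd, of n]
          by (simp add: g_def)
      qed
    qed
    moreover have "integral\<^sup>L lebesgue (g n) = a n * (\<zeta> - 0) ^ n" for n
    proof -
      have "g n = (\<lambda>t. (f t * ((- \<i> * of_real t) ^ n / fact n)) * \<zeta> ^ n)"
        unfolding g_def power_mult_distrib[of "- \<i> * of_real _" \<zeta>] by (rule ext) simp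
      then show ?thesis by (simp add: a_def)
    qed
    moreover have "(LINT t|lebesgue. (\<Sum>n. g n t)) = fourier_laplace f \<zeta>"
      unfolding fourier_laplace_def using pointwise by (simp add: sums_iff)
    ultimately show ?thesis by simp
  qed
  have "fourier_laplace f holomorphic_on UNIV"
    unfolding holomorphic_on_def
  proof
    fix \<zeta> :: complex
    have "fourier_laplace f holomorphic_on ball 0 (cmod \<zeta> + 1)"
      by (rule power_series_holomorphic[OF sums])
    then show "fourier_laplace f field_differentiable at \<zeta> within UNIV"
      by (auto intro!: holomorphic_on_imp_differentiable_at[of _ "ball 0 (cmod \<zeta> + 1)"])
  qed
  then show ?thesis by (rule holomorphic_on_subset) simp
qed

lemma AE_lebesgue_translate:
  assumes "AE t in lebesgue. R (t::real)"
  shows "AE t in lebesgue. R (t + a)"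
proof -
  obtain N where N: "N \<in> null_sets lebesgue" "{t. \<not> R t} \<subseteq> N"
    using assms by (auto simp: eventually_ae_filter)
  then have "negligible ((+) (- a) ` N)"
    by (intro negligible_translation) (simp add: negligible_iff_null_sets)
  moreover have "{t. \<not> R (t + a)} \<subseteq> (+) (- a) ` N"
  proof
    fix t assume "t \<in> {t. \<not> R (t + a)}"
    then have "t + a \<in> N" using N(2) by auto
    then show "t \<in> (+) (- a) ` N" by (rule rev_image_eqI) simp
  qed
  ultimately show ?thesis
    by (auto simp: eventually_ae_filter negligible_iff_null_sets)
qed

text \<open>The line is cut into unit intervals, which are all moved to \<open>[0,1)\<close>: the integral of \<open>g\<close> is the
integral over one period of its periodization. As \<open>g\<close> vanishes beyond \<open>B\<close>, shifts up to \<open>L\<close> suffice.\<close>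

lemma integral_eq_0_of_periodization_eq_0:
  fixes g :: "real \<Rightarrow> complex" and L :: int
  assumes g: "integrable lebesgue g" "vanishes_beyond B g" and L: "B + 1 \<le> of_int L"
    and zero: "AE t in lebesgue. 0 \<le> t \<longrightarrow> t < 1 \<longrightarrow> (\<Sum>i=-L..L. g (t - of_int i)) = 0"
  shows "integral\<^sup>L lebesgue g = 0"
proof -
  let ?\<chi> = "indicator {0..<1::real} :: real \<Rightarrow> real"
  have meas: "(\<lambda>t. ?\<chi> (t + a)) \<in> borel_measurable lebesgue" for a
  proof -
    have "(\<lambda>t. ?\<chi> (t + a)) = indicator {-a..<1-a}" by (auto simp: indicator_def fun_eq_iff)
    then show ?thesis by (simp only:) (rule borel_measurable_indicator, simp)
  qed
  have int: "integrable lebesgue (\<lambda>t. ?\<chi> (t + a) *\<^sub>R g t)" for a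
  proof (rule Bochner_Integration.integrable_bound[OF g(1)])
    show "(\<lambda>t. ?\<chi> (t + a) *\<^sub>R g t) \<in> borel_measurable lebesgue"
      using borel_measurable_integrable[OF g(1)] meas by (intro borel_measurable_scaleR)
    show "AE t in lebesgue. norm (?\<chi> (t + a) *\<^sub>R g t) \<le> norm (g t)"
      by (auto simp: indicator_def)
  qed
  have int': "integrable lebesgue (\<lambda>t. ?\<chi> t *\<^sub>R g (t - a))" for a
    using lebesgue_integrable_real_affine_iff[of 1 "\<lambda>t. ?\<chi> (t + a) *\<^sub>R g t" "- a"] int[of a] by simp
  have "integral\<^sup>L lebesgue g = (LINT t|lebesgue. (\<Sum>i=-L..L. ?\<chi> (t + of_int i) *\<^sub>R g t))"
  proof (rule integral_cong_AE)
    show "g \<in> borel_measurable lebesgue" using g(1) by simp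
    show "(\<lambda>t. \<Sum>i=-L..L. ?\<chi> (t + of_int i) *\<^sub>R g t) \<in> borel_measurable lebesgue"
      using int by (intro borel_measurable_sum borel_measurable_integrable)
    show "AE t in lebesgue. g t = (\<Sum>i=-L..L. ?\<chi> (t + of_int i) *\<^sub>R g t)"
      using g(2) unfolding vanishes_beyond_def
    proof eventually_elim
      case (elim t)
      show ?case
      proof (cases "\<bar>t\<bar> \<le> B")
        case True
        \<comment> \<open>Exactly one of the shifts of \<open>[0,1)\<close> contains \<open>t\<close>.\<close>
        have iff: "(t + of_int i \<in> {0..<1}) \<longleftrightarrow> i = - \<lfloor>t\<rfloor>" for i
          by (auto simp: floor_eq_iff; linarith)
        have \<chi>: "?\<chi> (t + of_int i) = (if i = - \<lfloor>t\<rfloor> then 1 else 0)" for i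
          using iff[of i] by (simp add: indicator_def del: atLeastLessThan_iff)
        have "- \<lfloor>t\<rfloor> \<in> {-L..L}" using True L by (auto simp: abs_le_iff; linarith)
        then have "(\<Sum>i=-L..L. ?\<chi> (t + of_int i)) = 1"
          by (simp only: \<chi> sum.delta finite_atLeastAtMost_int if_True)
        then show ?thesis by (simp flip: scaleR_sum_left)
      qed (use elim in simp)
    qed
  qed
  also have "\<dots> = (\<Sum>i=-L..L. LINT t|lebesgue. ?\<chi> (t + of_int i) *\<^sub>R g t)"
    using int by (intro Bochner_Integration.integral_sum)
  also have "\<dots> = (\<Sum>i=-L..L. LINT t|lebesgue. ?\<chi> t *\<^sub>R g (t - of_int i))"
  proof (rule sum.cong[OF refl])
    fix i :: int
    show "(LINT t|lebesgue. ?\<chi> (t + of_int i) *\<^sub>R g t) = (LINT t|lebesgue. ?\<chi> t *\<^sub>R g (t - of_int i))"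
      using lebesgue_integral_real_affine[of 1 "\<lambda>t. ?\<chi> (t + of_int i) *\<^sub>R g t" "- of_int i"] by simp
  qed
  also have "\<dots> = (LINT t|lebesgue. (\<Sum>i=-L..L. ?\<chi> t *\<^sub>R g (t - of_int i)))"
    using int' by (intro Bochner_Integration.integral_sum[symmetric])
  also have "\<dots> = 0"
  proof (rule integral_eq_zero_AE)
    show "AE t in lebesgue. (\<Sum>i=-L..L. ?\<chi> t *\<^sub>R g (t - of_int i)) = 0"
      using zero
    proof eventually_elim
      case (elim t)
      then show ?case
        by (cases "0 \<le> t \<and> t < 1") (auto simp: indicator_def simp flip: scaleR_sum_right)
    qed
  qed
  finally show ?thesis .
qed

lemma has_sum_finite_support:
  fixes f :: "'a \<Rightarrow> 'b :: {topological_comm_monoid_add, t2_space}"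
  assumes "(f has_sum s) UNIV" "finite S" "\<And>x. x \<notin> S \<Longrightarrow> f x = 0"
  shows "sum f S = s"
proof -
  have "(f has_sum s) S"
    using assms(1) by (rule has_sum_cong_neutral[THEN iffD1, rotated -1]) (use assms(3) in auto)
  then show ?thesis using has_sum_finite[OF assms(2)] by (rule has_sum_unique[THEN sym])
qed

text \<open>The exponential dependence relation says that \<open>f(t) exp(-i t \<zeta>)\<close> has periodization zero whenever
\<open>exp(i \<zeta>) = z\<close>. The solutions \<open>\<zeta>\<close> of that equation are the translates of a logarithm of \<open>z\<close> by
\<open>2 \<pi> \<int>\<close>.\<close>

lemma dependent_shifts_imp_common_zeros:
  assumes f: "integrable lebesgue f" "vanishes_beyond B f" "0 < B"
    and dep: "AE t in lebesgue. ((\<lambda>j. c j * f (t - of_int j)) has_sum 0) UNIV"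
    and c: "c l0 \<noteq> 0"
  shows "\<exists>\<zeta>. \<forall>k::int. fourier_laplace f (\<zeta> + of_real (2 * pi * of_int k)) = 0"
proof -
  obtain z where z: "z \<noteq> 0"
    and closure: "\<And>S a. finite S \<Longrightarrow> \<forall>l::int. (\<Sum>i\<in>S. a i * c (l + i)) = 0
              \<Longrightarrow> (\<Sum>i\<in>S. a i * z powi i) = 0"
    using exponential_in_annihilator[where c = c, OF c] by auto
  define L where "L = \<lceil>B\<rceil> + 1"
  have L: "B + 1 \<le> of_int L" unfolding L_def by simp
  \<comment> \<open>Only countably many translates are involved, so the exceptional null sets can be united.\<close>
  have "AE t in lebesgue. \<forall>l::int. (B < \<bar>t + of_int l\<bar> \<longrightarrow> f (t + of_int l) = 0) \<and>
          ((\<lambda>j. c j * f (t + of_int l - of_int j)) has_sum 0) UNIV"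
    unfolding AE_all_countable
    using f(2) dep by (intro allI AE_conjI AE_lebesgue_translate) (simp_all add: vanishes_beyond_def)
  then have exp_dep: "AE t in lebesgue. 0 \<le> t \<longrightarrow> t < 1 \<longrightarrow>
          (\<Sum>i=-L..L. f (t - of_int i) * z powi i) = 0"
  proof eventually_elim
    case (elim t)
    show ?case
    proof (intro impI closure allI)
      fix l :: int assume t: "0 \<le> t" "t < 1"
      have far: "f (t - of_int i) = 0" if "i \<notin> {-L..L}" for i
      proof -
        have "B < \<bar>t - of_int i\<bar>" using that t L by (auto simp: not_le; linarith)
        then show ?thesis using elim[rule_format, of "- i"] by simp
      qed
      have "(\<Sum>j\<in>(+) l ` {-L..L}. c j * f (t + of_int l - of_int j)) = 0"
      proof (rule has_sum_finite_support)
        show "((\<lambda>j. c j * f (t + of_int l - of_int j)) has_sum 0) UNIV" using elim by blast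
        fix j assume "j \<notin> (+) l ` {-L..L}"
        then have "j - l \<notin> {-L..L}" using image_eqI[of j "(+) l" "j - l" "{-L..L}"] by auto
        from far[OF this] show "c j * f (t + of_int l - of_int j) = 0" by (simp add: algebra_simps)
      qed simp
      then show "(\<Sum>i=-L..L. f (t - of_int i) * c (l + i)) = 0"
        by (subst (asm) sum.reindex) (auto simp: mult.commute)
    qed simp
  qed
  define w where "w = - \<i> * Ln z"
  have "fourier_laplace f (w + of_real (2 * pi * of_int k)) = 0" for k :: int
  proof -
    let ?\<zeta> = "w + of_real (2 * pi * of_int k)"
    have "exp (\<i> * ?\<zeta>) = exp (Ln z + (2 * of_int k * pi) * \<i>)"
      by (simp add: w_def algebra_simps)
    also have "\<dots> = z" using z by (simp add: exp_add exp_integer_2pi mult.commute mult.left_commute)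
    finally have ez: "exp (\<i> * ?\<zeta>) = z" .
    let ?u = "\<lambda>t::real. exp (- \<i> * of_real t * ?\<zeta>)"
    have cont: "continuous_on UNIV ?u" by (intro continuous_intros)
    have shift: "?u (t - of_int i) = ?u t * z powi i" for t i
      unfolding ez[symmetric] exp_power_int by (simp add: algebra_simps flip: exp_add)
    have "compact (?u ` {-B..B})"
      using cont by (intro compact_continuous_image) (auto intro: continuous_on_subset)
    then have "bounded (?u ` {-B..B})" by (rule compact_imp_bounded)
    then obtain C where "\<forall>x\<in>?u ` {-B..B}. norm x \<le> C" unfolding bounded_iff by (elim exE)
    then have C: "cmod (?u t) \<le> C" if "\<bar>t\<bar> \<le> B" for t
    proof -
      have "?u t \<in> ?u ` {-B..B}" using that by (intro imageI) auto
      with \<open>\<forall>x\<in>?u ` {-B..B}. norm x \<le> C\<close> show ?thesis by (rule bspec)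
    qed
    show ?thesis
      unfolding fourier_laplace_def
    proof (rule integral_eq_0_of_periodization_eq_0[OF _ _ L])
      show "integrable lebesgue (\<lambda>t. f t * ?u t)"
        by (rule integrable_times_continuous(1)[OF f(1,2) cont C])
      show "vanishes_beyond B (\<lambda>t. f t * ?u t)"
        using f(2) unfolding vanishes_beyond_def by eventually_elim simp
      show "AE t in lebesgue. 0 \<le> t \<longrightarrow> t < 1 \<longrightarrow>
              (\<Sum>i=-L..L. f (t - of_int i) * ?u (t - of_int i)) = 0"
        using exp_dep
      proof eventually_elim
        case (elim t)
        have "(\<Sum>i=-L..L. f (t - of_int i) * ?u (t - of_int i))
            = ?u t * (\<Sum>i=-L..L. f (t - of_int i) * z powi i)"
          unfolding shift sum_distrib_left by (intro sum.cong) (auto simp: mult_ac)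
        then show ?case using elim by simp
      qed
    qed
  qed
  then show ?thesis by blast
qed

section \<open>Refinement and the descent of common zeros\<close>

definition symbol_ext :: "(int \<Rightarrow> complex) \<Rightarrow> complex \<Rightarrow> complex" where
  "symbol_ext a \<zeta> = (\<Sum>k | a k \<noteq> 0. a k * exp (- \<i> * of_int k * \<zeta>))"

lemma symbol_eq_symbol_ext: "symbol a \<xi> = symbol_ext a (of_real \<xi>)"
  by (simp add: symbol_def symbol_ext_def)

lemma symbol_ext_entire: "symbol_ext a holomorphic_on S"
  unfolding symbol_ext_def by (intro holomorphic_intros)

lemma symbol_ext_periodic: "symbol_ext a (\<zeta> + of_real (2 * pi * of_int l)) = symbol_ext a \<zeta>"
proof -
  have "exp (- \<i> * of_int k * (\<zeta> + of_real (2 * pi * of_int l))) = exp (- \<i> * of_int k * \<zeta>)" for k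
  proof -
    have "- \<i> * of_int k * (\<zeta> + of_real (2 * pi * of_int l))
        = - \<i> * of_int k * \<zeta> + (2 * of_int (- k * l) * pi) * \<i>"
      by (simp add: algebra_simps)
    then show ?thesis by (simp only: exp_add exp_integer_2pi[OF Ints_of_int] mult_1_right)
  qed
  then show ?thesis by (simp only: symbol_ext_def)
qed

lemma entire_eq_of_eq_on_reals:
  assumes "f holomorphic_on UNIV" "g holomorphic_on UNIV"
    and "\<And>x::real. f (of_real x) = g (of_real x)"
  shows "f \<zeta> = g \<zeta>"
proof -
  have "f \<zeta> - g \<zeta> = 0"
  proof (rule analytic_continuation[of "\<lambda>z. f z - g z" UNIV \<real> 0])
    show "(\<lambda>z. f z - g z) holomorphic_on UNIV" using assms by (intro holomorphic_intros)
    show "(0::complex) islimpt \<real>"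
      unfolding islimpt_approachable
    proof (intro allI impI)
      fix e :: real assume "0 < e"
      then show "\<exists>x'\<in>\<real>. x' \<noteq> (0::complex) \<and> dist x' 0 < e"
        by (intro bexI[of _ "of_real (e / 2)"]) auto
    qed
    show "f z - g z = 0" if "z \<in> \<real>" for z using that assms(3) by (auto elim: Reals_cases)
  qed auto
  then show ?thesis by simp
qed

lemma has_prod_zero_imp_factor_zero:
  assumes "f has_prod 0"
  shows "\<exists>i. f i = 0"
  using assms by (auto simp: has_prod_def raw_has_prod_def)

text \<open>A convergent infinite product in the sense of \<open>has_prod\<close> vanishes only if one of its factors does.\<close>

lemma refinable_imp_symbol_zero:
  assumes "refinable_function d a \<phi>" "fourier \<phi> \<xi> = 0"
  shows "\<exists>i. symbol a (\<xi> / real d ^ Suc i) = 0"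
proof -
  have "(\<lambda>j. symbol a (\<xi> / real d ^ Suc j)) has_prod 0"
    using assms unfolding refinable_function_def by metis
  then show ?thesis by (rule has_prod_zero_imp_factor_zero)
qed

lemma fourier_refinement:
  assumes \<phi>: "refinable_function d a \<phi>" and d: "d > 0"
  shows "fourier \<phi> (real d * \<xi>) = symbol a \<xi> * fourier \<phi> \<xi>"
proof -
  have lim: "(\<lambda>n. \<Prod>j<n. symbol a (\<eta> / real d ^ Suc j)) \<longlonglongrightarrow> fourier \<phi> \<eta>" for \<eta>
    using \<phi> unfolding refinable_function_def by (intro has_prod_imp_tendsto') simp
  have "(\<lambda>n. symbol a \<xi> * (\<Prod>j<n. symbol a (\<xi> / real d ^ Suc j))) \<longlonglongrightarrow> symbol a \<xi> * fourier \<phi> \<xi>"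
    by (intro tendsto_mult_left lim)
  also have "(\<lambda>n. symbol a \<xi> * (\<Prod>j<n. symbol a (\<xi> / real d ^ Suc j)))
      = (\<lambda>n. \<Prod>j<Suc n. symbol a (real d * \<xi> / real d ^ Suc j))"
    unfolding prod.lessThan_Suc_shift using d by simp
  finally have "(\<lambda>n. \<Prod>j<Suc n. symbol a (real d * \<xi> / real d ^ Suc j)) \<longlonglongrightarrow> symbol a \<xi> * fourier \<phi> \<xi>" .
  then show ?thesis using LIMSEQ_Suc[OF lim[of "real d * \<xi>"]] LIMSEQ_unique by blast
qed

text \<open>The descent. \<open>Z\<close> is the set of common zeros of all \<open>2 \<pi> \<int>\<close>-translates of the transform. It is closed
and invariant under these translations, and a nonreal point of \<open>Z\<close> leads to another one whose
imaginary part is \<open>d\<close> times smaller. An element of least absolute imaginary part is therefore real,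
but a real point of \<open>Z\<close> would be a multiple of \<open>2 \<pi>\<close>, which makes the transform vanish at \<open>0\<close>.\<close>

theorem linearly_independent_of_symbol_zeros:
  assumes d: "d \<ge> 2" and a0: "symbol a 0 = 1" and \<phi>: "refinable_function d a \<phi>"
    and real_zeros: "\<And>\<xi>. symbol a \<xi> = 0 \<Longrightarrow> \<exists>k::int. real d * \<xi> = 2 * pi * of_int k"
    and no_symmetric_zeros: "\<And>\<zeta>. Im \<zeta> \<noteq> 0 \<Longrightarrow>
           \<exists>k<d. symbol_ext a (\<zeta> + of_real (2 * pi * real k / real d)) \<noteq> 0"
  shows "linearly_independent_shifts \<phi>"
proof (rule ccontr)
  assume "\<not> linearly_independent_shifts \<phi>"
  then obtain c l0 where dep: "AE t in lebesgue. ((\<lambda>j. c j * \<phi> (t - of_int j)) has_sum 0) UNIV"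
    and c: "c l0 \<noteq> 0"
    unfolding linearly_independent_shifts_def by auto
  obtain B where B: "0 < B" "vanishes_beyond B \<phi>"
    using \<phi> compactly_supported_vanishes_beyond unfolding refinable_function_def by metis
  have int: "integrable lebesgue \<phi>"
    using \<phi> B(2) integrable_of_L2 unfolding refinable_function_def by metis
  define F where "F = fourier_laplace \<phi>"
  have F_hol: "F holomorphic_on S" for S
    unfolding F_def by (rule fourier_laplace_entire[OF int B(2,1)])
  have F_real: "F (of_real \<xi>) = fourier \<phi> \<xi>" for \<xi>
    by (simp add: F_def fourier_eq_fourier_laplace)
  have refine: "F (of_nat d * \<zeta>) = symbol_ext a \<zeta> * F \<zeta>" for \<zeta>
  proof (rule entire_eq_of_eq_on_reals[of "\<lambda>\<zeta>. F (of_nat d * \<zeta>)"])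
    have "(F \<circ> (\<lambda>\<zeta>. of_nat d * \<zeta>)) holomorphic_on UNIV"
      using F_hol by (intro holomorphic_on_compose holomorphic_intros)
    then show "(\<lambda>\<zeta>. F (of_nat d * \<zeta>)) holomorphic_on UNIV" by (simp add: o_def)
    show "(\<lambda>\<zeta>. symbol_ext a \<zeta> * F \<zeta>) holomorphic_on UNIV"
      by (intro holomorphic_on_mult symbol_ext_entire F_hol)
    show "F (of_nat d * of_real x) = symbol_ext a (of_real x) * F (of_real x)" for x
      using fourier_refinement[OF \<phi>, of x] d F_real[of "real d * x"]
      by (simp add: F_real symbol_eq_symbol_ext)
  qed
  define Z where "Z = {\<zeta>. \<forall>k::int. F (\<zeta> + of_real (2 * pi * of_int k)) = 0}"
  have Z_closed: "closed Z"
    unfolding Z_def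
  proof (intro closed_Collect_all closed_Collect_eq)
    show "continuous_on UNIV (\<lambda>\<zeta>. F (\<zeta> + of_real (2 * pi * of_int k)))" for k :: int
      by (rule continuous_on_compose2[OF holomorphic_on_imp_continuous_on[OF F_hol[of UNIV]]])
         (intro continuous_on_add continuous_on_id continuous_on_const, simp)
  qed simp
  have Z_shift: "\<zeta> + of_real (2 * pi * of_int k) \<in> Z" if "\<zeta> \<in> Z" for \<zeta> and k :: int
  proof -
    have "F (\<zeta> + of_real (2 * pi * of_int k) + of_real (2 * pi * of_int l)) = 0" for l :: int
    proof -
      have "F (\<zeta> + of_real (2 * pi * of_int (k + l))) = 0" using that unfolding Z_def by blast
      then show ?thesis by (simp add: algebra_simps)
    qed
    then show ?thesis unfolding Z_def by blast
  qed
  have Z_reduce: "\<exists>\<eta>\<in>Z. Im \<eta> = Im \<zeta> \<and> 0 \<le> Re \<eta> \<and> Re \<eta> \<le> 2 * pi" if "\<zeta> \<in> Z" for \<zeta>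
  proof (intro bexI conjI)
    let ?q = "Re \<zeta> / (2 * pi)"
    show "\<zeta> + of_real (2 * pi * of_int (- \<lfloor>?q\<rfloor>)) \<in> Z" using that by (rule Z_shift)
    have q: "Re \<zeta> = 2 * pi * ?q" by simp
    have fl: "of_int \<lfloor>?q\<rfloor> \<le> ?q" "?q \<le> of_int \<lfloor>?q\<rfloor> + 1" by linarith+
    show "0 \<le> Re (\<zeta> + of_real (2 * pi * of_int (- \<lfloor>?q\<rfloor>)))"
      using mult_left_mono[OF fl(1), of "2 * pi"] by simp
    show "Re (\<zeta> + of_real (2 * pi * of_int (- \<lfloor>?q\<rfloor>))) \<le> 2 * pi"
      using mult_left_mono[OF fl(2), of "2 * pi"] by (simp add: algebra_simps)
  qed simp
  have Z_descend: "\<exists>\<eta>\<in>Z. Im \<eta> = Im \<zeta> / real d" if \<zeta>: "\<zeta> \<in> Z" "Im \<zeta> \<noteq> 0" for \<zeta>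
  proof -
    have "Im (\<zeta> / of_nat d) \<noteq> 0" using \<zeta>(2) d by simp
    then obtain k where k: "k < d"
      "symbol_ext a (\<zeta> / of_nat d + of_real (2 * pi * real k / real d)) \<noteq> 0" (is "symbol_ext a ?\<eta> \<noteq> 0")
      using no_symmetric_zeros by blast
    have "F (?\<eta> + of_real (2 * pi * of_int l)) = 0" for l :: int
    proof -
      let ?w = "?\<eta> + of_real (2 * pi * of_int l)"
      have "of_nat d * ?w = \<zeta> + of_real (2 * pi * of_int (int k + int d * l))"
        using d by (simp add: field_simps)
      moreover have "F (\<zeta> + of_real (2 * pi * of_int (int k + int d * l))) = 0"
        using \<zeta>(1) unfolding Z_def by blast
      ultimately have "F (of_nat d * ?w) = 0" by (simp only:)
      then have "symbol_ext a ?\<eta> * F ?w = 0" by (simp only: refine symbol_ext_periodic)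
      then show ?thesis using k(2) by simp
    qed
    then have "?\<eta> \<in> Z" unfolding Z_def by blast
    then show ?thesis by (rule bexI[rotated]) simp
  qed
  have Z_not_real: "of_real x \<notin> Z" for x :: real
  proof
    assume x: "of_real x \<in> Z"
    then have "F (of_real x + of_real (2 * pi * of_int 0)) = 0" unfolding Z_def by blast
    then have "fourier \<phi> x = 0" by (simp add: F_real)
    then obtain i where "symbol a (x / real d ^ Suc i) = 0"
      using refinable_imp_symbol_zero[OF \<phi>] by blast
    then obtain k :: int where "real d * (x / real d ^ Suc i) = 2 * pi * of_int k"
      using real_zeros by blast
    \<comment> \<open>Hence \<open>0\<close> is a translate of \<open>x\<close>.\<close>
    then have "x = 2 * pi * of_int (k * int d ^ i)" using d by (simp add: field_simps)
    then have "of_real x + of_real (2 * pi * of_int (- (k * int d ^ i))) = (0 :: complex)" by simp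
    then have "F 0 = 0" using x unfolding Z_def by (metis (mono_tags, lifting) mem_Collect_eq)
    then have "fourier \<phi> 0 = 0" using F_real[of 0] by simp
    then obtain i where "symbol a (0 / real d ^ Suc i) = 0"
      using refinable_imp_symbol_zero[OF \<phi>] by blast
    then show False using a0 by simp
  qed
  obtain \<zeta>0 where "\<zeta>0 \<in> Z"
    using dependent_shifts_imp_common_zeros[OF int B(2,1) dep c] unfolding Z_def F_def by blast
  \<comment> \<open>A window containing representatives of \<open>Z\<close> modulo \<open>2 \<pi>\<close>, made compact by the height of \<open>\<zeta>0\<close>.\<close>
  define S where "S = Z \<inter> cbox (Complex 0 (- \<bar>Im \<zeta>0\<bar>)) (Complex (2 * pi) \<bar>Im \<zeta>0\<bar>)"
  have in_S: "\<eta> \<in> S \<longleftrightarrow> \<eta> \<in> Z \<and> 0 \<le> Re \<eta> \<and> Re \<eta> \<le> 2 * pi \<and> \<bar>Im \<eta>\<bar> \<le> \<bar>Im \<zeta>0\<bar>" for \<eta>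
    by (auto simp: S_def in_cbox_complex_iff abs_le_iff)
  have "compact S" unfolding S_def by (intro closed_Int_compact Z_closed compact_cbox)
  moreover have "S \<noteq> {}"
  proof -
    obtain \<eta> where "\<eta> \<in> Z" "Im \<eta> = Im \<zeta>0" "0 \<le> Re \<eta>" "Re \<eta> \<le> 2 * pi"
      using Z_reduce[OF \<open>\<zeta>0 \<in> Z\<close>] by blast
    then have "\<eta> \<in> S" by (simp add: in_S)
    then show ?thesis by blast
  qed
  moreover have "continuous_on S (\<lambda>\<zeta>. \<bar>Im \<zeta>\<bar>)" by (intro continuous_intros)
  ultimately obtain \<zeta> where \<zeta>: "\<zeta> \<in> S" and min: "\<forall>\<eta>\<in>S. \<bar>Im \<zeta>\<bar> \<le> \<bar>Im \<eta>\<bar>"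
    by (rule continuous_attains_inf[THEN bexE])
  have "\<zeta> \<in> Z" and le: "\<bar>Im \<zeta>\<bar> \<le> \<bar>Im \<zeta>0\<bar>" using \<zeta> by (simp_all add: in_S)
  have nonreal: "Im \<zeta> \<noteq> 0"
  proof
    assume "Im \<zeta> = 0"
    then have "\<zeta> = of_real (Re \<zeta>)" by (simp add: complex_eq_iff)
    then show False using Z_not_real \<open>\<zeta> \<in> Z\<close> by metis
  qed
  obtain \<eta>' where \<eta>': "\<eta>' \<in> Z" "Im \<eta>' = Im \<zeta> / real d"
    using Z_descend[OF \<open>\<zeta> \<in> Z\<close> nonreal] by blast
  obtain \<eta> where \<eta>: "\<eta> \<in> Z" "Im \<eta> = Im \<eta>'" "0 \<le> Re \<eta>" "Re \<eta> \<le> 2 * pi"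
    using Z_reduce[OF \<eta>'(1)] by blast
  have smaller: "\<bar>Im \<eta>\<bar> < \<bar>Im \<zeta>\<bar>"
    using d nonreal by (simp add: \<eta>(2) \<eta>'(2) divide_less_eq)
  then have "\<eta> \<in> S" using \<eta> le by (simp add: in_S)
  with min smaller show False by force
qed

section \<open>Location of the zeros of the truncated series\<close>

definition compositions :: "'a set \<Rightarrow> nat \<Rightarrow> ('a \<Rightarrow> nat) set" where
  "compositions I j = {js. js \<in> I \<rightarrow>\<^sub>E {..j} \<and> (\<Sum>k\<in>I. js k) = j}"

lemma finite_compositions: "finite I \<Longrightarrow> finite (compositions I j)"
  unfolding compositions_def
  by (rule finite_subset[of _ "I \<rightarrow>\<^sub>E {..j}"]) (auto intro: finite_PiE)

lemma compositionsI:
  assumes "finite I" "js \<in> extensional I" "(\<Sum>k\<in>I. js k) = j"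
  shows "js \<in> compositions I j"
  using assms member_le_sum[of _ I js] unfolding compositions_def PiE_def by auto

text \<open>The weight \<open>js k\<close> kills the compositions in which part \<open>k\<close> is empty; the others arise from the
compositions of \<open>j\<close> by enlarging part \<open>k\<close> by one.\<close>

lemma sum_compositions_Suc:
  fixes g :: "('a \<Rightarrow> nat) \<Rightarrow> real"
  assumes I: "finite I" "k \<in> I"
  shows "(\<Sum>js\<in>compositions I (Suc j). real (js k) * g js)
       = (\<Sum>js\<in>compositions I j. real (js k + 1) * g (js(k := js k + 1)))"
proof -
  have upd: "(\<Sum>i\<in>I. (js(k := x)) i) + js k = (\<Sum>i\<in>I. js i) + x" for js :: "'a \<Rightarrow> nat" and x
    using I by (simp add: sum.remove[of I k] fun_upd_def)
  have "(\<Sum>js\<in>compositions I (Suc j). real (js k) * g js)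
      = (\<Sum>js\<in>{js\<in>compositions I (Suc j). js k > 0}. real (js k) * g js)"
    using finite_compositions[OF I(1)] by (intro sum.mono_neutral_right) auto
  also have "\<dots> = (\<Sum>js\<in>compositions I j. real (js k + 1) * g (js(k := js k + 1)))"
  proof (rule sum.reindex_bij_witness[of _ "\<lambda>js. js(k := js k + 1)" "\<lambda>js. js(k := js k - 1)"])
    fix js assume a: "js \<in> {js \<in> compositions I (Suc j). 0 < js k}"
    then have "js \<in> extensional I" "(\<Sum>i\<in>I. js i) = Suc j" "0 < js k"
      by (auto simp: compositions_def PiE_def)
    then show "js(k := js k - 1) \<in> compositions I j"
      using I upd[of js "js k - 1"] by (intro compositionsI) (auto simp: extensional_def)
  next
    fix js assume a: "js \<in> compositions I j"
    then have "js \<in> extensional I" "(\<Sum>i\<in>I. js i) = j"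
      by (auto simp: compositions_def PiE_def)
    then have "js(k := js k + 1) \<in> compositions I (Suc j)"
      using I upd[of js "js k + 1"] by (intro compositionsI) (auto simp: extensional_def)
    then show "js(k := js k + 1) \<in> {js \<in> compositions I (Suc j). 0 < js k}" by simp
  qed auto
  finally show ?thesis .
qed

text \<open>The factor \<open>j + 1\<close> on the right is the sum of the parts of a composition of \<open>j + 1\<close>. Distributing it
and removing one unit from the part that it counts gives compositions of \<open>j\<close>, weighted by
\<open>\<Sum>k\<in>I. (m + js k) = m |I| + j\<close>, which is at least \<open>m + j\<close>. This stands in for a differential equation
satisfied by the generating function.\<close>

lemma composition_sum_growth:
  fixes w :: "'a \<Rightarrow> nat \<Rightarrow> real"
  assumes I: "finite I" "I \<noteq> {}"
    and w0: "\<And>k i. k \<in> I \<Longrightarrow> w k i \<ge> 0"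
    and w: "\<And>k i. k \<in> I \<Longrightarrow> real (m + i) * w k i \<le> real (i + 1) * w k (i + 1)"
  shows "real (m + j) * (\<Sum>js\<in>compositions I j. \<Prod>k\<in>I. w k (js k))
       \<le> real (j + 1) * (\<Sum>js\<in>compositions I (j + 1). \<Prod>k\<in>I. w k (js k))"
proof -
  let ?W = "\<lambda>js. \<Prod>k\<in>I. w k (js k)"
  have W0: "?W js \<ge> 0" for js using w0 by (intro prod_nonneg) auto
  have card: "real (card I) \<ge> 1" using I by (simp add: Suc_leI card_gt_0_iff)
  have step: "real (m + js k) * ?W js \<le> real (js k + 1) * ?W (js(k := js k + 1))"
    if "k \<in> I" for k js
  proof -
    have "(\<Prod>i\<in>I - {k}. w i ((js(k := js k + 1)) i)) = (\<Prod>i\<in>I - {k}. w i (js i))"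
      by (rule prod.cong) auto
    then have *: "?W (js(k := js k + 1)) = w k (js k + 1) * (\<Prod>i\<in>I - {k}. w i (js i))"
      using I that by (simp add: prod.remove[of I k])
    have "(real (m + js k) * w k (js k)) * (\<Prod>i\<in>I - {k}. w i (js i))
        \<le> (real (js k + 1) * w k (js k + 1)) * (\<Prod>i\<in>I - {k}. w i (js i))"
      using that w0 by (intro mult_right_mono w prod_nonneg) auto
    then show ?thesis
      unfolding * using I that by (simp add: prod.remove[of I k] mult.assoc)
  qed
  have "real (m + j) * (\<Sum>js\<in>compositions I j. ?W js)
      = (\<Sum>js\<in>compositions I j. real (m + j) * ?W js)"
    by (rule sum_distrib_left)
  also have "\<dots> \<le> (\<Sum>js\<in>compositions I j. \<Sum>k\<in>I. real (m + js k) * ?W js)"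
  proof (rule sum_mono)
    fix js assume "js \<in> compositions I j"
    then have j: "(\<Sum>k\<in>I. js k) = j" by (simp add: compositions_def)
    have "(\<Sum>k\<in>I. real (m + js k)) = real (card I) * real m + real j"
      by (simp add: sum.distrib flip: j)
    moreover have "real m \<le> real (card I) * real m" using card by (simp add: mult_le_cancel_right1)
    ultimately have "real (m + j) \<le> (\<Sum>k\<in>I. real (m + js k))" by simp
    then show "real (m + j) * ?W js \<le> (\<Sum>k\<in>I. real (m + js k) * ?W js)"
      unfolding sum_distrib_right[symmetric] using W0 by (rule mult_right_mono)
  qed
  also have "\<dots> \<le> (\<Sum>js\<in>compositions I j. \<Sum>k\<in>I. real (js k + 1) * ?W (js(k := js k + 1)))"
    by (intro sum_mono step)
  also have "\<dots> = (\<Sum>k\<in>I. \<Sum>js\<in>compositions I j. real (js k + 1) * ?W (js(k := js k + 1)))"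
    by (rule sum.swap)
  also have "\<dots> = (\<Sum>k\<in>I. \<Sum>js\<in>compositions I (Suc j). real (js k) * ?W js)"
    by (rule sum.cong[OF refl], rule sum_compositions_Suc[OF I(1), symmetric])
  also have "\<dots> = (\<Sum>js\<in>compositions I (Suc j). \<Sum>k\<in>I. real (js k) * ?W js)"
    by (rule sum.swap)
  also have "\<dots> = (\<Sum>js\<in>compositions I (Suc j). real (j + 1) * ?W js)"
  proof (rule sum.cong[OF refl])
    fix js assume "js \<in> compositions I (Suc j)"
    then have "(\<Sum>k\<in>I. real (js k)) = real (j + 1)"
      by (simp add: compositions_def flip: of_nat_sum)
    then show "(\<Sum>k\<in>I. real (js k) * ?W js) = real (j + 1) * ?W js"
      by (simp add: sum_distrib_right[symmetric])
  qed
  finally show ?thesis by (simp add: sum_distrib_left)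
qed

lemma coeff_c_eq_compositions:
  "coeff_c d m j = (\<Sum>js\<in>compositions {1..d-1} j. \<Prod>k=1..d-1.
      real ((m - 1 + js k) choose js k) * (inverse (sin (real k * pi / real d)))\<^sup>2 ^ js k)"
  unfolding coeff_c_def compositions_def by (simp add: power_mult)

lemma sin_grid_pos:
  assumes "k \<in> {1..d-1}"
  shows "0 < sin (real k * pi / real d)"
proof (rule sin_gt_zero)
  show "0 < real k * pi / real d" using assms by (auto intro!: divide_pos_pos)
  have "real k * pi < real d * pi" using assms by auto
  then show "real k * pi / real d < pi" using assms by (simp add: field_simps)
qed

lemma coeff_c_0: "coeff_c d m 0 = 1"
proof -
  have "compositions {1..d-1} 0 = {\<lambda>k\<in>{1..d-1}. 0}"
    by (auto simp: compositions_def PiE_def extensional_def restrict_def fun_eq_iff)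
  then show ?thesis by (simp add: coeff_c_eq_compositions)
qed

text \<open>The growth lemma applies with factors \<open>binom(m-1+i, i) u^i\<close> and \<open>u = 1 / sin^2 \<ge> 1\<close>. It yields
\<open>(j + 1) c_{j+1} \<ge> (m + j) c_j\<close>, and \<open>m + j \<ge> 2 (j + 1)\<close> exactly when \<open>j + 2 \<le> m\<close>.\<close>

lemma coeff_c_doubling:
  assumes d: "d \<ge> 2" and j: "j + 1 < m"
  shows "0 < coeff_c d m j" "2 * coeff_c d m j \<le> coeff_c d m (j + 1)"
proof -
  have growth: "real (m + i) * coeff_c d m i \<le> real (i + 1) * coeff_c d m (i + 1)" for i
    unfolding coeff_c_eq_compositions
  proof (rule composition_sum_growth)
    fix k i assume k: "k \<in> {1..d-1}"
    let ?u = "(inverse (sin (real k * pi / real d)))\<^sup>2"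
    show "0 \<le> real ((m - 1 + i) choose i) * ?u ^ i" by simp
    have s: "0 < (sin (real k * pi / real d))\<^sup>2" using sin_grid_pos[OF k] by simp
    moreover have "(sin (real k * pi / real d))\<^sup>2 \<le> 1" by (simp add: abs_square_le_1)
    ultimately have "1 \<le> ?u" by (simp add: power_inverse one_le_inverse)
    have "(i + 1) * ((m - 1 + (i + 1)) choose (i + 1)) = (m + i) * ((m - 1 + i) choose i)"
      using Suc_times_binomial[of i "m - 1 + i"] j by simp
    then have "real (i + 1) * real ((m - 1 + (i + 1)) choose (i + 1))
        = real (m + i) * real ((m - 1 + i) choose i)"
      unfolding of_nat_mult[symmetric] by (rule arg_cong)
    then have "real (i + 1) * (real ((m - 1 + (i + 1)) choose (i + 1)) * ?u ^ (i + 1))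
        = (real (m + i) * (real ((m - 1 + i) choose i) * ?u ^ i)) * ?u"
      by (simp only: power_add power_one_right mult.assoc[symmetric])
    also have "\<dots> \<ge> (real (m + i) * (real ((m - 1 + i) choose i) * ?u ^ i)) * 1"
      using \<open>1 \<le> ?u\<close> by (intro mult_left_mono) auto
    finally show "real (m + i) * (real ((m - 1 + i) choose i) * ?u ^ i)
        \<le> real (i + 1) * (real ((m - 1 + (i + 1)) choose (i + 1)) * ?u ^ (i + 1))" by simp
  qed (use d in auto)
  have double: "2 * coeff_c d m i \<le> coeff_c d m (i + 1)"
    if "i + 1 < m" "0 < coeff_c d m i" for i
  proof -
    have "real ((i + 1) * 2) * coeff_c d m i \<le> real (m + i) * coeff_c d m i"
      using that by (intro mult_right_mono) (auto simp del: of_nat_mult of_nat_add)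
    then have "real (i + 1) * (2 * coeff_c d m i) \<le> real (m + i) * coeff_c d m i"
      by (simp add: algebra_simps)
    with growth[of i] have "real (i + 1) * (2 * coeff_c d m i) \<le> real (i + 1) * coeff_c d m (i + 1)"
      by linarith
    then show ?thesis by (rule mult_left_le_imp_le) simp
  qed
  show pos: "0 < coeff_c d m j" using j
  proof (induction j)
    case (Suc j)
    with double[of j] show ?case by simp
  qed (simp add: coeff_c_0)
  show "2 * coeff_c d m j \<le> coeff_c d m (j + 1)" using double[OF j pos] .
qed

lemma coeff_c_pos:
  assumes "d \<ge> 2" "j < m"
  shows "0 < coeff_c d m j"
proof (cases j)
  case (Suc i)
  then show ?thesis using coeff_c_doubling[of d i m] assms by simp
qed (simp add: coeff_c_0)

text \<open>Multiplication by \<open>w - 1\<close> turns the partial sums into the leading term \<open>b k * w ^ Suc k\<close> plus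
a remainder with coefficients \<open>b (j - 1) - b j\<close>. As \<open>b\<close> is nondecreasing these telescope, so the
remainder is at most \<open>b k |w|^k\<close> outside the unit disc and cannot cancel the leading term.\<close>

lemma Enestrom_Kakeya:
  fixes b :: "nat \<Rightarrow> real" and w :: complex
  assumes b0: "b 0 > 0" and mono: "\<And>j. j < n \<Longrightarrow> b j \<le> b (Suc j)"
    and zero: "(\<Sum>j\<le>n. of_real (b j) * w ^ j) = 0"
  shows "cmod w \<le> 1"
proof (rule ccontr)
  assume "\<not> cmod w \<le> 1"
  then have w: "1 < cmod w" by simp
  have "b k > 0 \<and> cmod ((w - 1) * (\<Sum>j\<le>k. of_real (b j) * w ^ j) - of_real (b k) * w ^ Suc k)
          \<le> b k * cmod w ^ k" if "k \<le> n" for k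
    using that
  proof (induction k)
    case 0
    show ?case using b0 by (simp add: algebra_simps norm_mult)
  next
    case (Suc k)
    let ?S = "\<lambda>k. \<Sum>j\<le>k. of_real (b j) * w ^ j"
    have IH: "b k > 0" "cmod ((w - 1) * ?S k - of_real (b k) * w ^ Suc k) \<le> b k * cmod w ^ k"
      using Suc by auto
    have mk: "b k \<le> b (Suc k)" using mono Suc.prems by simp
    have "(w - 1) * ?S (Suc k) - of_real (b (Suc k)) * w ^ Suc (Suc k)
        = ((w - 1) * ?S k - of_real (b k) * w ^ Suc k) - of_real (b (Suc k) - b k) * w ^ Suc k"
      by (simp add: algebra_simps)
    also have "cmod \<dots> \<le> b k * cmod w ^ k + cmod (of_real (b (Suc k) - b k) * w ^ Suc k)"
      by (rule order_trans[OF norm_triangle_ineq4 add_right_mono[OF IH(2)]])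
    also have "cmod (of_real (b (Suc k) - b k) * w ^ Suc k) = (b (Suc k) - b k) * cmod w ^ Suc k"
      using mk by (simp add: norm_mult norm_power del: of_real_diff power_Suc)
    also have "b k * cmod w ^ k \<le> b k * cmod w ^ Suc k"
      using IH(1) w by (intro mult_left_mono power_increasing) auto
    finally show ?case using IH mk by (simp add: algebra_simps)
  qed
  from this[OF order_refl] have bn: "b n > 0"
    and "cmod (of_real (b n) * w ^ Suc n) \<le> b n * cmod w ^ n"
    by (simp_all only: zero mult_zero_right diff_0 norm_minus_cancel)
  then have "b n * cmod w ^ Suc n \<le> b n * cmod w ^ n"
    by (simp add: norm_mult norm_power del: power_Suc)
  moreover have "cmod w ^ n < cmod w ^ Suc n" using w by (intro power_strict_increasing) auto
  ultimately show False using bn by simp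
qed

lemma poly_P: "poly (P d m N) x = (\<Sum>j<N. coeff_c d m j * x ^ j)"
  by (simp add: P_def poly_sum poly_monom)

lemma poly_map_P:
  "poly (map_poly complex_of_real (P d m N)) y = (\<Sum>j<N. of_real (coeff_c d m j) * y ^ j)"
proof -
  have "map_poly complex_of_real (P d m N) = (\<Sum>j<N. monom (of_real (coeff_c d m j)) j)"
    by (rule poly_eqI) (simp add: P_def coeff_map_poly coeff_sum if_distrib cong: if_cong)
  then show ?thesis by (simp add: poly_sum poly_monom)
qed

lemma poly_P_pos:
  assumes "d \<ge> 2" "1 \<le> N" "N \<le> m" "0 \<le> x"
  shows "0 < poly (P d m N) x"
proof -
  have "0 < coeff_c d m 0 * x ^ 0" by (simp add: coeff_c_0)
  also have "\<dots> \<le> (\<Sum>j<N. coeff_c d m j * x ^ j)"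
  proof (rule member_le_sum)
    fix j assume "j \<in> {..<N} - {0}"
    then have "0 < coeff_c d m j" using assms by (intro coeff_c_pos) auto
    then show "0 \<le> coeff_c d m j * x ^ j" using assms by simp
  qed (use assms in auto)
  finally show ?thesis by (simp add: poly_P)
qed

text \<open>As the coefficients double, Enestrom-Kakeya applies in the variable \<open>2 y\<close> and gives \<open>|y| \<le> 1/2\<close>. The
only point of this disc with real part at least \<open>1/2\<close> is \<open>1/2\<close> itself, where the polynomial is
positive.\<close>

lemma P_root_Re_less_half:
  assumes d: "d \<ge> 2" and N: "1 \<le> N" "N \<le> m"
    and root: "poly (map_poly complex_of_real (P d m N)) y = 0"
  shows "Re y < 1 / 2"
proof (rule ccontr)
  assume "\<not> Re y < 1 / 2"
  then have Re: "1 / 2 \<le> Re y" by simp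
  have "(\<Sum>j\<le>N - 1. of_real (coeff_c d m j / 2 ^ j) * (2 * y) ^ j)
      = (\<Sum>j<N. of_real (coeff_c d m j) * y ^ j)"
    using N by (intro sum.cong) (auto simp: power_mult_distrib)
  also have "\<dots> = 0" using root by (simp add: poly_map_P)
  finally have "cmod (2 * y) \<le> 1"
    using coeff_c_doubling[OF d, of _ m] N
    by (intro Enestrom_Kakeya[of "\<lambda>j. coeff_c d m j / 2 ^ j" "N - 1"])
       (auto simp: coeff_c_0 field_simps)
  then have cy: "cmod y \<le> 1 / 2" by (simp add: norm_mult)
  with Re complex_Re_le_cmod[of y] have Re': "Re y = 1 / 2" by simp
  from cy have "(cmod y)\<^sup>2 \<le> (1 / 2)\<^sup>2" by (intro power_mono) auto
  then have "Im y = 0" by (simp add: cmod_power2 Re')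
  with Re' have "y = of_real (1 / 2)" by (simp add: complex_eq_iff)
  moreover have "poly (map_poly complex_of_real (P d m N)) (of_real (1 / 2)) = of_real (poly (P d m N) (1 / 2))"
    unfolding poly_map_P poly_P by simp
  ultimately have "complex_of_real (poly (P d m N) (1 / 2)) = 0" using root by metis
  then show False using poly_P_pos[OF d N, of "1 / 2"] by (simp only: of_real_eq_0_iff) simp
qed

lemma sum_exp_grid:
  assumes "d \<ge> 2"
  shows "(\<Sum>k<d. exp (\<i> * (\<zeta> + of_real (2 * pi * real k / real d)))) = 0"
proof -
  let ?w = "exp (2 * of_real pi * \<i> / of_nat d)"
  have "?w ^ d = exp (of_nat d * (2 * of_real pi * \<i> / of_nat d))"
    by (rule exp_of_nat_mult[symmetric])
  then have wd: "?w ^ d = 1" using assms by simp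
  have w1: "?w \<noteq> 1"
  proof
    assume "?w = 1"
    then obtain n :: int where "2 * pi / real d = real_of_int (2 * n) * pi"
      by (auto simp: exp_eq_1)
    then have "1 = real_of_int n * real d" using assms by (simp add: field_simps)
    then have "1 = n * int d" by (metis of_int_1 of_int_eq_iff of_int_mult of_int_of_nat_eq)
    then have "int d dvd 1" by (rule dvdI[OF trans[OF _ mult.commute]])
    with assms show False by simp
  qed
  have "exp (\<i> * (\<zeta> + of_real (2 * pi * real k / real d))) = exp (\<i> * \<zeta>) * ?w ^ k" for k
    by (simp add: exp_add algebra_simps flip: exp_of_nat_mult)
  then have "(\<Sum>k<d. exp (\<i> * (\<zeta> + of_real (2 * pi * real k / real d))))
      = exp (\<i> * \<zeta>) * (\<Sum>k<d. ?w ^ k)"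
    by (simp add: sum_distrib_left)
  also have "(\<Sum>k<d. ?w ^ k) = 0" using w1 wd by (simp add: geometric_sum)
  finally show ?thesis by simp
qed

text \<open>By the half-angle formula the terms are \<open>1/2\<close> up to cosines of equally spaced arguments, which
cancel as multiples of sums over roots of unity.\<close>

lemma sum_sin_squared_grid:
  assumes "d \<ge> 2"
  shows "(\<Sum>k<d. (sin ((\<zeta> + of_real (2 * pi * real k / real d)) / 2))\<^sup>2) = of_nat d / (2 :: complex)"
proof -
  let ?t = "\<lambda>k. \<zeta> + of_real (2 * pi * real k / real d)"
  have half_angle: "(sin (s / 2))\<^sup>2 = (1 - (exp (\<i> * s) + exp (\<i> * - s)) / 2) / 2" for s :: complex
  proof -
    have "exp (\<i> * s) + exp (\<i> * - s) = 2 - 4 * (sin (s / 2))\<^sup>2"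
      using cos_double_sin[of "s / 2"] by (simp add: cos_exp_eq)
    then show ?thesis by (simp only:) (simp add: diff_divide_distrib)
  qed
  have sin: "(sin (?t k / 2))\<^sup>2 = (1 - (exp (\<i> * ?t k) + exp (\<i> * - ?t k)) / 2) / 2" for k
    by (rule half_angle)
  \<comment> \<open>The conjugate of this sum is one over the same grid, with \<open>cnj \<zeta>\<close> in place of \<open>\<zeta>\<close>.\<close>
  have conj: "(\<Sum>k<d. exp (\<i> * - ?t k)) = 0"
  proof -
    have "(\<Sum>k<d. exp (\<i> * - ?t k)) = cnj (\<Sum>k<d. exp (\<i> * (cnj \<zeta> + of_real (2 * pi * real k / real d))))"
      by (simp add: exp_cnj algebra_simps)
    then show ?thesis by (simp only: sum_exp_grid[OF assms] complex_cnj_zero)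
  qed
  have "(\<Sum>k<d. (sin (?t k / 2))\<^sup>2)
      = (of_nat d - ((\<Sum>k<d. exp (\<i> * ?t k)) + (\<Sum>k<d. exp (\<i> * - ?t k))) / 2) / 2"
    unfolding sin by (simp only: sum_divide_distrib[symmetric] sum_subtractf sum.distrib) simp
  then show ?thesis using sum_exp_grid[OF assms] conj by simp
qed

text \<open>Roots have real part less than \<open>1/2\<close>, while the points on the grid have average \<open>1/2\<close>.\<close>

lemma P_not_all_roots_on_grid:
  assumes "d \<ge> 2" "1 \<le> N" "N \<le> m"
  shows "\<exists>k<d. poly (map_poly complex_of_real (P d m N))
       ((sin ((\<zeta> + of_real (2 * pi * real k / real d)) / 2))\<^sup>2) \<noteq> 0"
proof (rule ccontr)
  assume "\<not> ?thesis"
  then have "Re ((sin ((\<zeta> + of_real (2 * pi * real k / real d)) / 2))\<^sup>2) < 1 / 2" if "k < d" for k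
    using P_root_Re_less_half[OF assms] that by blast
  then have "(\<Sum>k<d. Re ((sin ((\<zeta> + of_real (2 * pi * real k / real d)) / 2))\<^sup>2)) < (\<Sum>k<d. 1 / 2)"
    using assms by (intro sum_strict_mono) (auto simp: lessThan_empty_iff)
  moreover have "(\<Sum>k<d. Re ((sin ((\<zeta> + of_real (2 * pi * real k / real d)) / 2))\<^sup>2)) = real d / 2"
    by (simp only: Re_sum[symmetric] sum_sin_squared_grid[OF assms(1)]) simp
  ultimately show False by simp
qed

section \<open>The masks of pseudo splines\<close>

definition h_ext :: "nat \<Rightarrow> complex \<Rightarrow> complex" where
  "h_ext d y = (\<Prod>k=1..d-1. 1 - y / of_real ((sin (real k * pi / real d))\<^sup>2))"

definition mask_ext :: "nat \<Rightarrow> nat \<Rightarrow> nat \<Rightarrow> complex \<Rightarrow> complex" where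
  "mask_ext d m n \<zeta> = h_ext d ((sin (\<zeta> / 2))\<^sup>2) ^ m *
     poly (map_poly complex_of_real (P d m n)) ((sin (\<zeta> / 2))\<^sup>2)"

lemma mask_ext_entire: "mask_ext d m n holomorphic_on S"
  unfolding mask_ext_def h_ext_def poly_map_P
  by (intro holomorphic_intros) auto

lemma poly_map_P_of_real:
  "poly (map_poly complex_of_real (P d m n)) (of_real x) = of_real (poly (P d m n) x)"
  by (simp add: poly_map_P poly_P)

lemma sin_half_squared_of_real: "(sin (complex_of_real \<xi> / 2))\<^sup>2 = of_real ((sin (\<xi> / 2))\<^sup>2)"
  using sin_of_real[of "\<xi> / 2", where ?'a = complex] by simp

lemma mask_ext_of_real: "mask_ext d m n (of_real \<xi>) = of_real (type_II_mask d m n \<xi>)"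
  unfolding mask_ext_def type_II_mask_def sin_half_squared_of_real poly_map_P_of_real
  by (simp add: h_ext_def h_def)

text \<open>A zero forces \<open>sin^2(\<zeta>/2) = sin^2(k \<pi> / d)\<close>, and the solutions \<open>\<zeta>\<close> of this equation are real
multiples of \<open>2 \<pi> / d\<close>.\<close>

lemma h_ext_zero:
  assumes d: "d \<ge> 2" and zero: "h_ext d ((sin (\<zeta> / 2))\<^sup>2) = 0"
  shows "\<exists>k::int. of_nat d * \<zeta> = of_real (2 * pi * of_int k)"
proof -
  obtain k where k: "k \<in> {1..d-1}"
    and "1 - (sin (\<zeta> / 2))\<^sup>2 / of_real ((sin (real k * pi / real d))\<^sup>2) = 0"
    using zero unfolding h_ext_def by auto
  then have "(sin (\<zeta> / 2))\<^sup>2 = (sin (of_real (real k * pi / real d)))\<^sup>2"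
    using sin_grid_pos[OF k] unfolding sin_of_real by simp
  then consider "sin (\<zeta> / 2) = sin (of_real (real k * pi / real d))"
    | "sin (\<zeta> / 2) = sin (- of_real (real k * pi / real d))"
    unfolding sin_minus power2_eq_iff by blast
  then obtain s :: int where "sin (\<zeta> / 2) = sin (of_real (real_of_int s * pi / real d))"
  proof cases
    case 1 then show ?thesis by (intro that[of "int k"]) simp
  next
    case 2 then show ?thesis by (intro that[of "- int k"]) simp
  qed
  then obtain n where n: "n \<in> \<int>"
    and "\<zeta> / 2 = of_real (of_int s * pi / real d) + of_real (2 * n * pi)
       \<or> \<zeta> / 2 = - of_real (of_int s * pi / real d) + of_real ((2 * n + 1) * pi)"
    unfolding complex_sin_eq by blast
  moreover obtain l where "n = of_int l" using n by (auto elim: Ints_cases)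
  ultimately consider
      "\<zeta> = 2 * (of_real (of_int s * pi / real d) + of_real (2 * of_int l * pi))"
    | "\<zeta> = 2 * (- of_real (of_int s * pi / real d) + of_real ((2 * of_int l + 1) * pi))"
    by force
  then show ?thesis
  proof cases
    case 1
    then show ?thesis using d by (intro exI[of _ "s + 2 * int d * l"]) (simp add: field_simps)
  next
    case 2
    then show ?thesis using d by (intro exI[of _ "- s + int d * (2 * l + 1)"]) (simp add: field_simps)
  qed
qed

text \<open>The common form of the three cases. The first alternative for a zero is impossible off the real
line, so symmetric nonreal zeros would put roots of the polynomial on a whole grid; the second is
impossible on the real line, where the argument of the polynomial is nonnegative.\<close>

lemma linearly_independent_of_mask_zeros:
  assumes d: "d \<ge> 2" and N: "1 \<le> N" "N \<le> m"
    and a: "low_pass_filter a" and \<phi>: "refinable_function d a \<phi>"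
    and zeros: "\<And>\<zeta>. symbol_ext a \<zeta> = 0 \<Longrightarrow>
        (\<exists>k::int. of_nat d * \<zeta> = of_real (2 * pi * of_int k)) \<or>
        poly (map_poly complex_of_real (P d m N)) ((sin (\<zeta> / 2))\<^sup>2) = 0"
  shows "linearly_independent_shifts \<phi>"
proof (rule linearly_independent_of_symbol_zeros[OF d _ \<phi>])
  show "symbol a 0 = 1" using a by (simp add: low_pass_filter_def)
next
  fix \<xi> assume "symbol a \<xi> = 0"
  moreover have "poly (map_poly complex_of_real (P d m N)) ((sin (of_real \<xi> / 2))\<^sup>2) \<noteq> 0"
    using poly_P_pos[OF d N, of "(sin (\<xi> / 2))\<^sup>2"]
    unfolding sin_half_squared_of_real poly_map_P_of_real by simp
  ultimately obtain k :: int where "of_nat d * complex_of_real \<xi> = of_real (2 * pi * of_int k)"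
    using zeros[of "of_real \<xi>"] by (auto simp: symbol_eq_symbol_ext)
  then have "complex_of_real (real d * \<xi>) = of_real (2 * pi * of_int k)" by simp
  then show "\<exists>k::int. real d * \<xi> = 2 * pi * of_int k" by (simp only: of_real_eq_iff) blast
next
  fix \<zeta> :: complex assume nonreal: "Im \<zeta> \<noteq> 0"
  obtain k where k: "k < d" "poly (map_poly complex_of_real (P d m N))
       ((sin ((\<zeta> + of_real (2 * pi * real k / real d)) / 2))\<^sup>2) \<noteq> 0" (is "poly _ ((sin (?\<eta> / 2))\<^sup>2) \<noteq> 0")
    using P_not_all_roots_on_grid[OF d N] by blast
  have "of_nat d * ?\<eta> \<noteq> of_real (2 * pi * of_int l)" for l :: int
  proof
    assume "of_nat d * ?\<eta> = of_real (2 * pi * of_int l)"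
    then have "Im (of_nat d * ?\<eta>) = 0" by (metis Im_complex_of_real)
    then show False using nonreal d by simp
  qed
  with zeros[of ?\<eta>] k(2) have "symbol_ext a ?\<eta> \<noteq> 0" by blast
  with k(1) show "\<exists>k<d. symbol_ext a (\<zeta> + of_real (2 * pi * real k / real d)) \<noteq> 0" by blast
qed

lemma mask_ext_zero:
  assumes "d \<ge> 2" "mask_ext d m n \<zeta> = 0"
  shows "(\<exists>k::int. of_nat d * \<zeta> = of_real (2 * pi * of_int k)) \<or>
     poly (map_poly complex_of_real (P d m n)) ((sin (\<zeta> / 2))\<^sup>2) = 0"
proof -
  have "h_ext d ((sin (\<zeta> / 2))\<^sup>2) = 0
      \<or> poly (map_poly complex_of_real (P d m n)) ((sin (\<zeta> / 2))\<^sup>2) = 0"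
    using assms(2) unfolding mask_ext_def by auto
  then show ?thesis using h_ext_zero[OF assms(1)] by blast
qed

lemma type_II_linearly_independent:
  assumes d: "d \<ge> 2" and \<phi>: "pseudo_spline_type_II d m n \<phi>"
  shows "linearly_independent_shifts \<phi>"
proof -
  obtain a where n: "1 \<le> n" "n \<le> m" and a: "low_pass_filter a" "refinable_function d a \<phi>"
    and sym: "\<And>\<xi>. symbol a \<xi> = of_real (type_II_mask d m n \<xi>)"
    using \<phi> unfolding pseudo_spline_type_II_def by blast
  have "symbol_ext a \<zeta> = mask_ext d m n \<zeta>" for \<zeta>
    by (rule entire_eq_of_eq_on_reals)
       (simp_all add: symbol_ext_entire mask_ext_entire mask_ext_of_real sym flip: symbol_eq_symbol_ext)
  then show ?thesis
    using mask_ext_zero[OF d] by (intro linearly_independent_of_mask_zeros[OF d n a]) simp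
qed

lemma real_type_I_linearly_independent:
  assumes d: "d \<ge> 2" and \<phi>: "real_pseudo_spline_type_I d m n \<phi>"
  shows "linearly_independent_shifts \<phi>"
proof -
  obtain a where n: "1 \<le> n" "n \<le> m" and a: "low_pass_filter a" "refinable_function d a \<phi>"
    and sym: "\<And>\<xi>. (cmod (symbol a \<xi>))\<^sup>2 = type_II_mask d m n \<xi>"
    using \<phi> unfolding real_pseudo_spline_type_I_def by blast
  \<comment> \<open>On the real line \<open>b\<close> is the conjugate of the symbol, so that the squared modulus extends to an entire product.\<close>
  define b where "b \<zeta> = (\<Sum>k | a k \<noteq> 0. cnj (a k) * exp (\<i> * of_int k * \<zeta>))" for \<zeta>
  have b_entire: "b holomorphic_on UNIV" unfolding b_def by (intro holomorphic_intros)
  have b_real: "b (of_real \<xi>) = cnj (symbol a \<xi>)" for \<xi>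
    by (simp add: b_def symbol_def exp_cnj)
  have "symbol_ext a \<zeta> * b \<zeta> = mask_ext d m n \<zeta>" for \<zeta>
  proof (rule entire_eq_of_eq_on_reals[of "\<lambda>\<zeta>. symbol_ext a \<zeta> * b \<zeta>"])
    show "(\<lambda>\<zeta>. symbol_ext a \<zeta> * b \<zeta>) holomorphic_on UNIV"
      by (intro holomorphic_on_mult symbol_ext_entire b_entire)
    show "mask_ext d m n holomorphic_on UNIV" by (rule mask_ext_entire)
    show "symbol_ext a (of_real x) * b (of_real x) = mask_ext d m n (of_real x)" for x
      unfolding mask_ext_of_real b_real symbol_eq_symbol_ext[symmetric] sym[symmetric]
      by (rule complex_norm_square[symmetric])
  qed
  then have "mask_ext d m n \<zeta> = 0" if "symbol_ext a \<zeta> = 0" for \<zeta>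
    using that by (metis mult_zero_left)
  then show ?thesis
    using mask_ext_zero[OF d] by (intro linearly_independent_of_mask_zeros[OF d n a]) simp
qed

text \<open>The selected numbers are nonreal, hence nonzero, so the normalising factor of \<open>Q\<close> does not vanish
and a zero of \<open>Q\<close> is one of the selected roots.\<close>

lemma Q_zero_imp_P_zero:
  assumes zs: "root_selection d m n zs" and zero: "Q zs y = 0"
  shows "poly (map_poly complex_of_real (P d m (2 * n - 1))) y = 0"
proof -
  have "0 \<notin> set zs" using zs Reals_0 unfolding root_selection_def by blast
  then have "prod_list zs \<noteq> 0" by (simp add: prod_list_zero_iff)
  then have "y \<in> set zs" using zero by (auto simp: Q_def prod_list_zero_iff)
  then have "y \<in># proots (map_poly complex_of_real (P d m (2 * n - 1)))"
    using zs by (simp add: root_selection_def)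
  then show ?thesis
    by (cases "map_poly complex_of_real (P d m (2 * n - 1)) = 0") auto
qed

text \<open>Multiplying the geometric sum by \<open>1 - exp(-i \<zeta>)\<close> gives \<open>1 - exp(-i d \<zeta>)\<close>.\<close>

lemma sum_exp_zero:
  assumes "(\<Sum>k<d. exp (- \<i> * of_nat k * \<zeta>)) = 0"
  shows "\<exists>k::int. of_nat d * \<zeta> = of_real (2 * pi * of_int k)"
proof -
  have pow: "exp (- \<i> * of_nat k * \<zeta>) = exp (- \<i> * \<zeta>) ^ k" for k
    by (simp add: mult_ac flip: exp_of_nat_mult)
  have "1 - exp (- \<i> * \<zeta>) ^ d = 0"
    using assms unfolding pow by (simp add: one_diff_power_eq)
  then have "exp (- \<i> * of_nat d * \<zeta>) = 1" unfolding pow by simp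
  then obtain n :: int where "Re (- \<i> * of_nat d * \<zeta>) = 0" "Im (- \<i> * of_nat d * \<zeta>) = of_int (2 * n) * pi"
    unfolding exp_eq_1 by blast
  then have "of_nat d * \<zeta> = of_real (2 * pi * of_int (- n))" by (auto simp: complex_eq_iff algebra_simps)
  then show ?thesis by blast
qed

lemma complex_type_I_linearly_independent:
  assumes d: "d \<ge> 2" and \<phi>: "complex_pseudo_spline_type_I d m n \<phi>"
  shows "linearly_independent_shifts \<phi>"
proof -
  obtain a zs where n: "1 \<le> n" "2 * n - 1 \<le> m" and a: "low_pass_filter a" "refinable_function d a \<phi>"
    and zs: "root_selection d m n zs"
    and sym: "\<And>\<xi>. symbol a \<xi> =
             exp (\<i> * of_nat (m * (d - 1) div 2) * of_real \<xi>) *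
             ((\<Sum>k<d. exp (- \<i> * of_nat k * of_real \<xi>)) / of_nat d) ^ m *
             Q zs (of_real ((sin (\<xi> / 2))\<^sup>2))"
    using \<phi> unfolding complex_pseudo_spline_type_I_def by blast
  have Q_poly: "\<exists>q. \<forall>y. Q zs y = poly q y"
  proof -
    have "(\<Prod>z\<leftarrow>zs. y - z) = poly (\<Prod>z\<leftarrow>zs. [:- z, 1:]) y" for y
      by (induction zs) (simp_all add: algebra_simps)
    then have "Q zs y = poly (smult ((- 1) ^ length zs * inverse (prod_list zs)) (\<Prod>z\<leftarrow>zs. [:- z, 1:])) y" for y
      by (simp add: Q_def)
    then show ?thesis by blast
  qed
  then obtain q where q: "\<And>y. Q zs y = poly q y" by blast
  let ?g = "\<lambda>\<zeta>. exp (\<i> * of_nat (m * (d - 1) div 2) * \<zeta>) *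
             ((\<Sum>k<d. exp (- \<i> * of_nat k * \<zeta>)) / of_nat d) ^ m * Q zs ((sin (\<zeta> / 2))\<^sup>2)"
  have ext: "symbol_ext a \<zeta> = ?g \<zeta>" for \<zeta>
  proof (rule entire_eq_of_eq_on_reals[of "symbol_ext a" ?g])
    show "?g holomorphic_on UNIV"
      unfolding q poly_altdef using d by (intro holomorphic_intros) auto
    show "symbol_ext a (of_real x) = ?g (of_real x)" for x
      unfolding symbol_eq_symbol_ext[symmetric] sym sin_half_squared_of_real ..
  qed (rule symbol_ext_entire)
  have N: "1 \<le> 2 * n - 1" using n by simp
  show ?thesis
  proof (rule linearly_independent_of_mask_zeros[OF d N n(2) a])
    fix \<zeta> assume "symbol_ext a \<zeta> = 0"
    then have "(\<Sum>k<d. exp (- \<i> * of_nat k * \<zeta>)) = 0 \<or> Q zs ((sin (\<zeta> / 2))\<^sup>2) = 0"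
      using d unfolding ext by auto
    then show "(\<exists>k::int. of_nat d * \<zeta> = of_real (2 * pi * of_int k)) \<or>
        poly (map_poly complex_of_real (P d m (2 * n - 1))) ((sin (\<zeta> / 2))\<^sup>2) = 0"
      using sum_exp_zero Q_zero_imp_P_zero[OF zs] by blast
  qed
qed

theorem theorem8:
  fixes d m n :: nat and \<phi> :: "real \<Rightarrow> complex"
  assumes "d \<ge> 2"
    and "pseudo_spline_type_II d m n \<phi> \<or> real_pseudo_spline_type_I d m n \<phi>
           \<or> complex_pseudo_spline_type_I d m n \<phi>"
  shows "linearly_independent_shifts \<phi>"
  using assms type_II_linearly_independent real_type_I_linearly_independent
    complex_type_I_linearly_independent by blast

end
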